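(* Let $A$ be a brick-finite finite dimensional algebra over a field $k$. Then $A$ is representation-directed if and only if $A$ is representation-finite and the length of the lattice $\operatorname{tors} A$ is $|\operatorname{ind} A|$.
   Context: $\operatorname{mod} A$ is the category of finitely generated left $A$-modules and $\operatorname{ind} A$ is the set of isomorphism classes of indecomposable modules in $\operatorname{mod} A$. $A$ is representation-finite if $\operatorname{ind} A$ is finite. $A$ is brick-finite if there are only finitely many isomorphism classes of bricks (modules whose endomorphism algebra is a division algebra); equivalently, the lattice $\operatorname{tors} A$ of torsion classes in $\operatorname{mod} A$, ordered by inclusion, is finite. A cycle in $\operatorname{mod} A$ is a sequence $X_0\xrightarrow{f_1}X_1\to\cdots\xrightarrow{f_t}X_t$ with $t\ge 1$, all $X_i$ indecomposable, $X_0\simeq X_t$, and each $f_i$ a non-zero non-invertible morphism; $A$ is representation-directed if no indecomposable module lies on a cycle. The length of a finite lattice is the largest $r$ for which there is a chain $x_0<x_1<\cdots<x_r$. *)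

theory Defs
  imports "HOL-Algebra.Module" "HOL-Algebra.AbelCoset"
begin

text \<open>
  The library's \<^locale>\<open>module\<close> and \<^locale>\<open>algebra\<close> require commutative rings, so left modules over
  an arbitrary ring are introduced here, with the same axioms and the same record type.
  As for \<^locale>\<open>module\<close>, the \<open>mult\<close> and \<open>one\<close> fields of the record of a module are
  irrelevant: two records that differ only there are isomorphic modules.
\<close>

locale left_module = R?: ring R + M?: abelian_group M
  for R :: "('a, 'r) ring_scheme" (structure) and M :: "('a, 'm, 'n) module_scheme" (structure) +
  assumes smult_closed [simp, intro]:
      "\<lbrakk>a \<in> carrier R; x \<in> carrier M\<rbrakk> \<Longrightarrow> a \<odot>\<^bsub>M\<^esub> x \<in> carrier M"
    and smult_l_distr:
      "\<lbrakk>a \<in> carrier R; b \<in> carrier R; x \<in> carrier M\<rbrakk> \<Longrightarrow>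
      (a \<oplus> b) \<odot>\<^bsub>M\<^esub> x = a \<odot>\<^bsub>M\<^esub> x \<oplus>\<^bsub>M\<^esub> b \<odot>\<^bsub>M\<^esub> x"
    and smult_r_distr:
      "\<lbrakk>a \<in> carrier R; x \<in> carrier M; y \<in> carrier M\<rbrakk> \<Longrightarrow>
      a \<odot>\<^bsub>M\<^esub> (x \<oplus>\<^bsub>M\<^esub> y) = a \<odot>\<^bsub>M\<^esub> x \<oplus>\<^bsub>M\<^esub> a \<odot>\<^bsub>M\<^esub> y"
    and smult_assoc1:
      "\<lbrakk>a \<in> carrier R; b \<in> carrier R; x \<in> carrier M\<rbrakk> \<Longrightarrow>
      (a \<otimes> b) \<odot>\<^bsub>M\<^esub> x = a \<odot>\<^bsub>M\<^esub> (b \<odot>\<^bsub>M\<^esub> x)"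
    and smult_one [simp]:
      "x \<in> carrier M \<Longrightarrow> \<one> \<odot>\<^bsub>M\<^esub> x = x"

definition finitely_generated ::
    "('a, 'r) ring_scheme \<Rightarrow> ('a, 'm, 'n) module_scheme \<Rightarrow> bool" where
  "finitely_generated R M \<longleftrightarrow>
    (\<exists>S. finite S \<and> S \<subseteq> carrier M \<and>
      carrier M = {(\<Oplus>\<^bsub>M\<^esub>s\<in>S. c s \<odot>\<^bsub>M\<^esub> s) | c. c \<in> S \<rightarrow> carrier R})"

text \<open>Finite dimensional associative unital algebras over a field; the zero algebra is allowed.\<close>

locale fin_dim_algebra = K?: field K + A?: ring A + module K A
  for K :: "('k, 'r) ring_scheme" (structure) and A :: "('k, 'a, 's) module_scheme" (structure) +
  assumes smult_mult_left:
      "\<lbrakk>c \<in> carrier K; x \<in> carrier A; y \<in> carrier A\<rbrakk> \<Longrightarrow>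
      (c \<odot>\<^bsub>A\<^esub> x) \<otimes>\<^bsub>A\<^esub> y = c \<odot>\<^bsub>A\<^esub> (x \<otimes>\<^bsub>A\<^esub> y)"
    and smult_mult_right:
      "\<lbrakk>c \<in> carrier K; x \<in> carrier A; y \<in> carrier A\<rbrakk> \<Longrightarrow>
      x \<otimes>\<^bsub>A\<^esub> (c \<odot>\<^bsub>A\<^esub> y) = c \<odot>\<^bsub>A\<^esub> (x \<otimes>\<^bsub>A\<^esub> y)"
    and finite_dimensional: "finitely_generated K A"

text \<open>Homomorphisms are extensional functions, so that equality of homomorphisms is HOL equality.\<close>

definition mod_hom ::
    "('a, 'r) ring_scheme \<Rightarrow> ('a, 'm, 'p) module_scheme \<Rightarrow> ('a, 'n, 'q) module_scheme \<Rightarrow> ('m \<Rightarrow> 'n) set"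
  where "mod_hom R M N = {f \<in> carrier M \<rightarrow>\<^sub>E carrier N.
    (\<forall>x\<in>carrier M. \<forall>y\<in>carrier M. f (x \<oplus>\<^bsub>M\<^esub> y) = f x \<oplus>\<^bsub>N\<^esub> f y) \<and>
    (\<forall>a\<in>carrier R. \<forall>x\<in>carrier M. f (a \<odot>\<^bsub>M\<^esub> x) = a \<odot>\<^bsub>N\<^esub> f x)}"

definition mod_iso ::
    "('a, 'r) ring_scheme \<Rightarrow> ('a, 'm, 'p) module_scheme \<Rightarrow> ('a, 'n, 'q) module_scheme \<Rightarrow> ('m \<Rightarrow> 'n) set"
  where "mod_iso R M N = {f \<in> mod_hom R M N. bij_betw f (carrier M) (carrier N)}"

definition mod_isomorphic ::
    "('a, 'r) ring_scheme \<Rightarrow> ('a, 'm, 'p) module_scheme \<Rightarrow> ('a, 'n, 'q) module_scheme \<Rightarrow> bool"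
  where "mod_isomorphic R M N \<longleftrightarrow> mod_iso R M N \<noteq> {}"

text \<open>
  A finitely generated left module over \<open>A\<close> is a quotient of \<open>A\<^sup>n\<close>, so up to isomorphism
  it can be realised on a subset of the type of lists over the underlying type of \<open>A\<close>; see
  lemma \<open>fg_module_in_mod_cat\<close> below. The objects of \<open>mod A\<close> are the modules realised in
  this way.
\<close>

definition mod_cat :: "('a, 'r) ring_scheme \<Rightarrow> ('a, 'a list) module set" where
  "mod_cat A = {M. left_module A M \<and> finitely_generated A M}"

definition indecomposable ::
    "('a, 'r) ring_scheme \<Rightarrow> ('a, 'm, 'p) module_scheme \<Rightarrow> bool" where
  "indecomposable A M \<longleftrightarrow> carrier M \<noteq> {\<zero>\<^bsub>M\<^esub>} \<and>
    (\<forall>U V. submodule U A M \<and> submodule V A M \<and>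
      U \<inter> V = {\<zero>\<^bsub>M\<^esub>} \<and> U <+>\<^bsub>M\<^esub> V = carrier M \<longrightarrow>
      U = {\<zero>\<^bsub>M\<^esub>} \<or> V = {\<zero>\<^bsub>M\<^esub>})"

definition iso_rel ::
    "('a, 'r) ring_scheme \<Rightarrow> ('a, 'a list) module rel" where
  "iso_rel A = {(M, N). M \<in> mod_cat A \<and> N \<in> mod_cat A \<and> mod_isomorphic A M N}"

definition ind :: "('a, 'r) ring_scheme \<Rightarrow> ('a, 'a list) module set set" where
  "ind A = {M \<in> mod_cat A. indecomposable A M} // iso_rel A"

definition rep_finite :: "('a, 'r) ring_scheme \<Rightarrow> bool" where
  "rep_finite A \<longleftrightarrow> finite (ind A)"

definition end_ring ::
    "('a, 'r) ring_scheme \<Rightarrow> ('a, 'm, 'p) module_scheme \<Rightarrow> ('m \<Rightarrow> 'm) ring" where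
  "end_ring A M = \<lparr>carrier = mod_hom A M M,
     mult = compose (carrier M),
     one = (\<lambda>x\<in>carrier M. x),
     zero = (\<lambda>x\<in>carrier M. \<zero>\<^bsub>M\<^esub>),
     add = (\<lambda>f g. \<lambda>x\<in>carrier M. f x \<oplus>\<^bsub>M\<^esub> g x)\<rparr>"

text \<open>As in the library's \<^locale>\<open>field\<close>; the equation for the units forces \<open>\<one> \<noteq> \<zero>\<close>.\<close>

locale div_ring = ring +
  assumes div_ring_Units: "Units R = carrier R - {\<zero>}"

definition bricks :: "('a, 'r) ring_scheme \<Rightarrow> ('a, 'a list) module set" where
  "bricks A = {M \<in> mod_cat A. div_ring (end_ring A M)}"

definition brick_finite :: "('a, 'r) ring_scheme \<Rightarrow> bool" where
  "brick_finite A \<longleftrightarrow> finite (bricks A // iso_rel A)"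

text \<open>\<open>X 0 \<rightarrow> X 1 \<rightarrow> \<dots> \<rightarrow> X t\<close>, where \<open>f i\<close> is the morphism from \<open>X (i - 1)\<close> to \<open>X i\<close>.\<close>

definition mod_cycle ::
    "('a, 'r) ring_scheme \<Rightarrow> nat \<Rightarrow> (nat \<Rightarrow> ('a, 'a list) module) \<Rightarrow>
      (nat \<Rightarrow> 'a list \<Rightarrow> 'a list) \<Rightarrow> bool" where
  "mod_cycle A t X f \<longleftrightarrow> t \<ge> 1 \<and>
    (\<forall>i\<le>t. X i \<in> mod_cat A \<and> indecomposable A (X i)) \<and>
    mod_isomorphic A (X 0) (X t) \<and>
    (\<forall>i\<in>{1..t}. f i \<in> mod_hom A (X (i - 1)) (X i) \<and>
      f i \<noteq> (\<lambda>x\<in>carrier (X (i - 1)). \<zero>\<^bsub>X i\<^esub>) \<and>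
      f i \<notin> mod_iso A (X (i - 1)) (X i))"

definition rep_directed :: "('a, 'r) ring_scheme \<Rightarrow> bool" where
  "rep_directed A \<longleftrightarrow>
    (\<forall>M\<in>mod_cat A. indecomposable A M \<longrightarrow>
      \<not> (\<exists>t X f. mod_cycle A t X f \<and> (\<exists>i\<le>t. X i = M)))"

definition short_exact ::
    "('a, 'r) ring_scheme \<Rightarrow> ('a, 'l, 'o) module_scheme \<Rightarrow> ('l \<Rightarrow> 'm) \<Rightarrow> ('a, 'm, 'p) module_scheme \<Rightarrow>
      ('m \<Rightarrow> 'n) \<Rightarrow> ('a, 'n, 'q) module_scheme \<Rightarrow> bool" where
  "short_exact A L f M g N \<longleftrightarrow>
    f \<in> mod_hom A L M \<and> inj_on f (carrier L) \<and>
    g \<in> mod_hom A M N \<and> g ` carrier M = carrier N \<and>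
    f ` carrier L = {x \<in> carrier M. g x = \<zero>\<^bsub>N\<^esub>}"

text \<open>
  Torsion classes are the nonempty classes of modules closed under factor modules and extensions.
  A factor module is any target of an epimorphism; in particular a torsion class is closed under
  isomorphism and contains all zero modules.
\<close>

definition torsion_class ::
    "('a, 'r) ring_scheme \<Rightarrow> ('a, 'a list) module set \<Rightarrow> bool" where
  "torsion_class A T \<longleftrightarrow> T \<subseteq> mod_cat A \<and> T \<noteq> {} \<and>
    (\<forall>M\<in>T. \<forall>N\<in>mod_cat A. (\<exists>g\<in>mod_hom A M N. g ` carrier M = carrier N) \<longrightarrow> N \<in> T) \<and>
    (\<forall>L\<in>T. \<forall>N\<in>T. \<forall>M\<in>mod_cat A. (\<exists>f g. short_exact A L f M g N) \<longrightarrow> M \<in> T)"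

definition tors :: "('a, 'r) ring_scheme \<Rightarrow> ('a, 'a list) module set gorder" where
  "tors A = \<lparr>carrier = {T. torsion_class A T}, eq = (=), le = (\<subseteq>)\<rparr>"

text \<open>Meaningful for lattices with bounded chain lengths, in particular for finite ones.\<close>

definition lattice_length :: "('a, 'b) gorder_scheme \<Rightarrow> nat" where
  "lattice_length L = (GREATEST r. \<exists>x. (\<forall>i\<le>r. x i \<in> carrier L) \<and> (\<forall>i<r. x i \<sqsubset>\<^bsub>L\<^esub> x (Suc i)))"


subsection \<open>Adequacy\<close>

lemma mod_homD:
  assumes "f \<in> mod_hom R M N"
  shows "\<And>x. x \<in> carrier M \<Longrightarrow> f x \<in> carrier N"
    and "\<And>x y. \<lbrakk>x \<in> carrier M; y \<in> carrier M\<rbrakk> \<Longrightarrow> f (x \<oplus>\<^bsub>M\<^esub> y) = f x \<oplus>\<^bsub>N\<^esub> f y"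
    and "\<And>a x. \<lbrakk>a \<in> carrier R; x \<in> carrier M\<rbrakk> \<Longrightarrow> f (a \<odot>\<^bsub>M\<^esub> x) = a \<odot>\<^bsub>N\<^esub> f x"
    and "f \<in> extensional (carrier M)"
  using assms by (auto simp: mod_hom_def PiE_def)

lemma mod_hom_zero:
  assumes "left_module R M" "left_module R N" "f \<in> mod_hom R M N"
  shows "f \<zero>\<^bsub>M\<^esub> = \<zero>\<^bsub>N\<^esub>"
proof -
  interpret M: left_module R M by fact
  interpret N: left_module R N by fact
  note f = mod_homD[OF assms(3)]
  have "f \<zero>\<^bsub>M\<^esub> \<oplus>\<^bsub>N\<^esub> f \<zero>\<^bsub>M\<^esub> = f \<zero>\<^bsub>M\<^esub>"
    using f(2)[of "\<zero>\<^bsub>M\<^esub>" "\<zero>\<^bsub>M\<^esub>"] by simp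
  then show ?thesis
    using f(1) M.M.zero_closed by (metis N.M.add.l_cancel_one')
qed

lemma mod_hom_finsum:
  assumes "left_module R M" "left_module R N" "f \<in> mod_hom R M N"
    and "finite S" "v \<in> S \<rightarrow> carrier M"
  shows "f (finsum M v S) = (\<Oplus>\<^bsub>N\<^esub>s\<in>S. f (v s))"
proof -
  interpret M: left_module R M by fact
  interpret N: left_module R N by fact
  note f = mod_homD[OF assms(3)]
  show ?thesis
    using assms(4,5)
  proof (induction S rule: finite_induct)
    case empty
    then show ?case using mod_hom_zero[OF assms(1-3)] by simp
  next
    case (insert x F)
    then have "v \<in> F \<rightarrow> carrier M" "v x \<in> carrier M" by auto
    moreover have "(\<lambda>s. f (v s)) \<in> F \<rightarrow> carrier N" "f (v x) \<in> carrier N"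
      using insert.prems f(1) by auto
    ultimately show ?case
      using insert f(2) by (simp add: M.M.finsum_insert N.M.finsum_insert M.M.finsum_closed)
  qed
qed

lemma finitely_generated_iso:
  assumes "left_module R M" "left_module R N" "f \<in> mod_iso R M N" "finitely_generated R M"
  shows "finitely_generated R N"
proof -
  interpret M: left_module R M by fact
  interpret N: left_module R N by fact
  from assms(3) have hom: "f \<in> mod_hom R M N" and bij: "bij_betw f (carrier M) (carrier N)"
    by (auto simp: mod_iso_def)
  note f = mod_homD[OF hom]
  from assms(4) obtain S where S: "finite S" "S \<subseteq> carrier M"
    "carrier M = {(\<Oplus>\<^bsub>M\<^esub>s\<in>S. c s \<odot>\<^bsub>M\<^esub> s) | c. c \<in> S \<rightarrow> carrier R}"
    unfolding finitely_generated_def by blast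
  have inj: "inj_on f S"
    using bij S(2) by (meson bij_betw_def inj_on_subset)
  have eq: "f (\<Oplus>\<^bsub>M\<^esub>s\<in>S. c (f s) \<odot>\<^bsub>M\<^esub> s) = (\<Oplus>\<^bsub>N\<^esub>s\<in>f ` S. c s \<odot>\<^bsub>N\<^esub> s)"
    if c: "c \<in> f ` S \<rightarrow> carrier R" for c
  proof -
    have cf: "c (f s) \<in> carrier R" "s \<in> carrier M" if "s \<in> S" for s
      using that c S(2) by auto
    have "f (\<Oplus>\<^bsub>M\<^esub>s\<in>S. c (f s) \<odot>\<^bsub>M\<^esub> s) = (\<Oplus>\<^bsub>N\<^esub>s\<in>S. f (c (f s) \<odot>\<^bsub>M\<^esub> s))"
      using S(1,2) c by (intro mod_hom_finsum[OF assms(1,2) hom]) auto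
    also have "\<dots> = (\<Oplus>\<^bsub>N\<^esub>s\<in>S. c (f s) \<odot>\<^bsub>N\<^esub> f s)"
      using cf f by (intro N.M.finsum_cong') (auto simp: f(3)[OF cf])
    also have "\<dots> = (\<Oplus>\<^bsub>N\<^esub>s\<in>f ` S. c s \<odot>\<^bsub>N\<^esub> s)"
      using S(1,2) c f(1) inj by (subst N.M.finsum_reindex) auto
    finally show ?thesis .
  qed
  have "carrier N = {(\<Oplus>\<^bsub>N\<^esub>s\<in>f ` S. c s \<odot>\<^bsub>N\<^esub> s) | c. c \<in> f ` S \<rightarrow> carrier R}" (is "_ = ?G")
  proof
    show "carrier N \<subseteq> ?G"
    proof
      fix y assume "y \<in> carrier N"
      then obtain x where x: "x \<in> carrier M" "y = f x"
        using bij by (auto simp: bij_betw_def)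
      then obtain c where c: "c \<in> S \<rightarrow> carrier R" "x = (\<Oplus>\<^bsub>M\<^esub>s\<in>S. c s \<odot>\<^bsub>M\<^esub> s)"
        using S(3) by blast
      define d where "d = c \<circ> inv_into S f"
      have d: "d \<in> f ` S \<rightarrow> carrier R" and "\<And>s. s \<in> S \<Longrightarrow> d (f s) = c s"
        using c inj by (auto simp: d_def)
      then have "x = (\<Oplus>\<^bsub>M\<^esub>s\<in>S. d (f s) \<odot>\<^bsub>M\<^esub> s)"
        unfolding c(2) using S(2) c(1) by (intro M.M.finsum_cong') auto
      then show "y \<in> ?G" using eq[OF d] x(2) d by auto
    qed
    show "?G \<subseteq> carrier N"
      using S(2) f(1) by (auto intro!: N.M.finsum_closed N.smult_closed)
  qed
  moreover have "f ` S \<subseteq> carrier N" using S(2) f(1) by auto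
  ultimately show ?thesis
    unfolding finitely_generated_def using S(1) by blast
qed

lemma left_module_transport:
  fixes R :: "('a, 'r) ring_scheme" and M :: "('a, 'm, 'p) module_scheme" and g :: "'m \<Rightarrow> 'n"
  assumes "left_module R M" and g: "inj_on g (carrier M)"
  shows "\<exists>N :: ('a, 'n) module. left_module R N \<and> mod_isomorphic R M N"
proof -
  interpret M: left_module R M by fact
  define h where "h = inv_into (carrier M) g"
  have hg [simp]: "h (g x) = x" if "x \<in> carrier M" for x
    using that g by (simp add: h_def)
  define N :: "('a, 'n) module" where
    "N = \<lparr>carrier = g ` carrier M, mult = (\<lambda>u v. u), one = g \<zero>\<^bsub>M\<^esub>,
      zero = g \<zero>\<^bsub>M\<^esub>, add = (\<lambda>u v. g (h u \<oplus>\<^bsub>M\<^esub> h v)), smult = (\<lambda>a u. g (a \<odot>\<^bsub>M\<^esub> h u))\<rparr>"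
  have ag: "abelian_group N"
  proof (rule abelian_groupI)
    fix x assume "x \<in> carrier N"
    then obtain u where "u \<in> carrier M" "x = g u" by (auto simp: N_def)
    then show "\<exists>y\<in>carrier N. y \<oplus>\<^bsub>N\<^esub> x = \<zero>\<^bsub>N\<^esub>"
      by (intro bexI[of _ "g (\<ominus>\<^bsub>M\<^esub> u)"]) (auto simp: N_def M.M.l_neg)
  qed (auto simp: N_def M.M.a_ac)
  have "left_module_axioms R N"
    by unfold_locales
      (auto simp: N_def M.smult_l_distr M.smult_r_distr M.smult_assoc1)
  with ag have N: "left_module R N"
    by (intro left_module.intro M.R.ring_axioms)
  have "(\<lambda>x\<in>carrier M. g x) \<in> mod_iso R M N"
    using g by (auto simp: mod_iso_def mod_hom_def N_def bij_betw_def inj_on_def)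
  with N show ?thesis by (auto simp: mod_isomorphic_def)
qed

text \<open>The type of lists is large enough: no finitely generated module is lost.\<close>

lemma fg_module_in_mod_cat:
  fixes M :: "('a, 'm, 'p) module_scheme"
  assumes "left_module A M" "finitely_generated A M"
  shows "\<exists>N\<in>mod_cat A. mod_isomorphic A M N"
proof -
  from assms(2) obtain S where S: "finite S"
    "carrier M = {(\<Oplus>\<^bsub>M\<^esub>s\<in>S. c s \<odot>\<^bsub>M\<^esub> s) | c. c \<in> S \<rightarrow> carrier A}"
    and SM: "S \<subseteq> carrier M"
    unfolding finitely_generated_def by blast
  interpret M: left_module A M by fact
  obtain xs where xs: "set xs = S" using S(1) finite_list by blast
  have "\<forall>x\<in>carrier M. \<exists>c. c \<in> S \<rightarrow> carrier A \<and> x = (\<Oplus>\<^bsub>M\<^esub>s\<in>S. c s \<odot>\<^bsub>M\<^esub> s)"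
    using S(2) by blast
  then obtain c where c: "\<And>x. x \<in> carrier M \<Longrightarrow> c x \<in> S \<rightarrow> carrier A"
    "\<And>x. x \<in> carrier M \<Longrightarrow> x = (\<Oplus>\<^bsub>M\<^esub>s\<in>S. c x s \<odot>\<^bsub>M\<^esub> s)"
    by metis
  have "inj_on (\<lambda>x. map (c x) xs) (carrier M)"
  proof (rule inj_onI)
    fix x y assume xy: "x \<in> carrier M" "y \<in> carrier M" "map (c x) xs = map (c y) xs"
    then have "\<And>s. s \<in> S \<Longrightarrow> c x s = c y s" using xs by auto
    then have "(\<Oplus>\<^bsub>M\<^esub>s\<in>S. c x s \<odot>\<^bsub>M\<^esub> s) = (\<Oplus>\<^bsub>M\<^esub>s\<in>S. c y s \<odot>\<^bsub>M\<^esub> s)"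
      using c(1)[OF xy(1)] c(1)[OF xy(2)] SM by (intro M.M.finsum_cong') auto
    then show "x = y" using c(2) xy by metis
  qed
  from left_module_transport[OF assms(1) this]
  obtain N :: "('a, 'a list) module" where N: "left_module A N" "mod_isomorphic A M N" by blast
  then obtain f where "f \<in> mod_iso A M N" by (auto simp: mod_isomorphic_def)
  with N assms have "finitely_generated A N" by (blast intro: finitely_generated_iso)
  with N show ?thesis by (auto simp: mod_cat_def)
qed

lemma ring_end_ring:
  assumes "left_module A M"
  shows "ring (end_ring A M)"
proof -
  interpret M: left_module A M by fact
  have m [simp]: "carrier (end_ring A M) = mod_hom A M M"
    "mult (end_ring A M) = compose (carrier M)" "one (end_ring A M) = (\<lambda>x\<in>carrier M. x)"
    "zero (end_ring A M) = (\<lambda>x\<in>carrier M. \<zero>\<^bsub>M\<^esub>)"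
    "add (end_ring A M) = (\<lambda>f g. \<lambda>x\<in>carrier M. f x \<oplus>\<^bsub>M\<^esub> g x)"
    by (simp_all add: end_ring_def)
  have smz: "a \<odot>\<^bsub>M\<^esub> \<zero>\<^bsub>M\<^esub> = \<zero>\<^bsub>M\<^esub>" if "a \<in> carrier A" for a
    using M.smult_r_distr[OF that, of "\<zero>\<^bsub>M\<^esub>" "\<zero>\<^bsub>M\<^esub>"] that by simp
  have smn: "\<ominus>\<^bsub>M\<^esub> (a \<odot>\<^bsub>M\<^esub> x) = a \<odot>\<^bsub>M\<^esub> (\<ominus>\<^bsub>M\<^esub> x)" if "a \<in> carrier A" "x \<in> carrier M" for a x
    using M.smult_r_distr[OF that(1), of x "\<ominus>\<^bsub>M\<^esub> x"] that smz[OF that(1)]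
    by (simp add: M.M.r_neg M.M.minus_equality M.M.a_comm)
  have memI: "f \<in> mod_hom A M M"
    if "f \<in> extensional (carrier M)" "\<And>x. x \<in> carrier M \<Longrightarrow> f x \<in> carrier M"
      "\<And>x y. \<lbrakk>x \<in> carrier M; y \<in> carrier M\<rbrakk> \<Longrightarrow> f (x \<oplus>\<^bsub>M\<^esub> y) = f x \<oplus>\<^bsub>M\<^esub> f y"
      "\<And>a x. \<lbrakk>a \<in> carrier A; x \<in> carrier M\<rbrakk> \<Longrightarrow> f (a \<odot>\<^bsub>M\<^esub> x) = a \<odot>\<^bsub>M\<^esub> f x" for f
    using that by (auto simp: mod_hom_def PiE_def)
  show ?thesis
  proof (rule ringI)
    show "abelian_group (end_ring A M)"
    proof (rule abelian_groupI)
      fix f g assume fg: "f \<in> carrier (end_ring A M)" "g \<in> carrier (end_ring A M)"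
      note f = mod_homD[OF fg(1)[unfolded m]] and g = mod_homD[OF fg(2)[unfolded m]]
      show "f \<oplus>\<^bsub>end_ring A M\<^esub> g \<in> carrier (end_ring A M)"
        unfolding m using f g by (intro memI) (auto simp: M.smult_r_distr M.M.a_ac)
      show "f \<oplus>\<^bsub>end_ring A M\<^esub> g = g \<oplus>\<^bsub>end_ring A M\<^esub> f"
        unfolding m using f g by (auto simp: M.M.a_comm fun_eq_iff)
      fix h assume "h \<in> carrier (end_ring A M)"
      note h = mod_homD[OF this[unfolded m]]
      show "f \<oplus>\<^bsub>end_ring A M\<^esub> g \<oplus>\<^bsub>end_ring A M\<^esub> h = f \<oplus>\<^bsub>end_ring A M\<^esub> (g \<oplus>\<^bsub>end_ring A M\<^esub> h)"
        unfolding m using f g h by (auto simp: M.M.a_assoc fun_eq_iff)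
    next
      show "\<zero>\<^bsub>end_ring A M\<^esub> \<in> carrier (end_ring A M)"
        unfolding m by (intro memI) (auto simp: smz)
    next
      fix f assume f0: "f \<in> carrier (end_ring A M)"
      note f = mod_homD[OF f0[unfolded m]]
      show "\<zero>\<^bsub>end_ring A M\<^esub> \<oplus>\<^bsub>end_ring A M\<^esub> f = f"
        unfolding m by (rule extensionalityI[OF _ f(4)]) (use f in auto)
      have "(\<lambda>x\<in>carrier M. \<ominus>\<^bsub>M\<^esub> f x) \<in> mod_hom A M M"
        using f by (intro memI) (auto simp: smn M.M.minus_add)
      then show "\<exists>g\<in>carrier (end_ring A M). g \<oplus>\<^bsub>end_ring A M\<^esub> f = \<zero>\<^bsub>end_ring A M\<^esub>"
        unfolding m using f by (intro bexI) (auto simp: M.M.l_neg fun_eq_iff)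
    qed
  next
    show "Group.monoid (end_ring A M)"
    proof (rule monoidI)
      fix f g assume fg: "f \<in> carrier (end_ring A M)" "g \<in> carrier (end_ring A M)"
      note f = mod_homD[OF fg(1)[unfolded m]] and g = mod_homD[OF fg(2)[unfolded m]]
      show "f \<otimes>\<^bsub>end_ring A M\<^esub> g \<in> carrier (end_ring A M)"
        unfolding m using f g by (intro memI) (auto simp: compose_def)
      fix h assume "h \<in> carrier (end_ring A M)"
      note h = mod_homD[OF this[unfolded m]]
      show "f \<otimes>\<^bsub>end_ring A M\<^esub> g \<otimes>\<^bsub>end_ring A M\<^esub> h = f \<otimes>\<^bsub>end_ring A M\<^esub> (g \<otimes>\<^bsub>end_ring A M\<^esub> h)"
        unfolding m using f g h by (auto simp: compose_def fun_eq_iff)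
    next
      show "\<one>\<^bsub>end_ring A M\<^esub> \<in> carrier (end_ring A M)"
        unfolding m by (intro memI) auto
    next
      fix f assume f0: "f \<in> carrier (end_ring A M)"
      note f = mod_homD[OF f0[unfolded m]]
      show "\<one>\<^bsub>end_ring A M\<^esub> \<otimes>\<^bsub>end_ring A M\<^esub> f = f" "f \<otimes>\<^bsub>end_ring A M\<^esub> \<one>\<^bsub>end_ring A M\<^esub> = f"
        unfolding m by (rule extensionalityI[OF _ f(4)]; use f in \<open>auto simp: compose_def\<close>)+
    qed
  next
    fix f g h assume fgh: "f \<in> carrier (end_ring A M)" "g \<in> carrier (end_ring A M)" "h \<in> carrier (end_ring A M)"
    note f = mod_homD[OF fgh(1)[unfolded m]] and g = mod_homD[OF fgh(2)[unfolded m]]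
      and h = mod_homD[OF fgh(3)[unfolded m]]
    show "(f \<oplus>\<^bsub>end_ring A M\<^esub> g) \<otimes>\<^bsub>end_ring A M\<^esub> h =
        f \<otimes>\<^bsub>end_ring A M\<^esub> h \<oplus>\<^bsub>end_ring A M\<^esub> g \<otimes>\<^bsub>end_ring A M\<^esub> h"
      unfolding m using f g h by (auto simp: compose_def fun_eq_iff)
    show "h \<otimes>\<^bsub>end_ring A M\<^esub> (f \<oplus>\<^bsub>end_ring A M\<^esub> g) =
        h \<otimes>\<^bsub>end_ring A M\<^esub> f \<oplus>\<^bsub>end_ring A M\<^esub> h \<otimes>\<^bsub>end_ring A M\<^esub> g"
      unfolding m using f g h by (auto simp: compose_def fun_eq_iff)
  qed
qed

lemma zero_module_in_mod_cat:
  assumes "ring A"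
  shows "\<exists>Z\<in>mod_cat A. carrier Z = {\<zero>\<^bsub>Z\<^esub>}"
proof -
  interpret R: ring A by fact
  define Z :: "('a, 'a list) module" where
    "Z = \<lparr>carrier = {[]}, mult = (\<lambda>u v. u), one = [], zero = [], add = (\<lambda>u v. []), smult = (\<lambda>a u. [])\<rparr>"
  have "abelian_group Z" by (rule abelian_groupI) (auto simp: Z_def)
  moreover have "left_module_axioms A Z" by unfold_locales (auto simp: Z_def)
  ultimately have Z: "left_module A Z" by (intro left_module.intro assms)
  then interpret Z: left_module A Z .
  have "carrier Z = {(\<Oplus>\<^bsub>Z\<^esub>s\<in>{}. c s \<odot>\<^bsub>Z\<^esub> s) | c. c \<in> {} \<rightarrow> carrier A}"
    by (simp add: Z.M.finsum_empty) (simp add: Z_def)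
  then have "finitely_generated A Z"
    unfolding finitely_generated_def by (intro exI[of _ "{}"]) auto
  with Z show ?thesis by (intro bexI[of _ Z]) (auto simp: mod_cat_def Z_def)
qed

lemma torsion_classD:
  assumes "torsion_class A T"
  shows "T \<subseteq> mod_cat A" and "T \<noteq> {}"
    and "\<And>M N g. \<lbrakk>M \<in> T; N \<in> mod_cat A; g \<in> mod_hom A M N; g ` carrier M = carrier N\<rbrakk> \<Longrightarrow> N \<in> T"
    and "\<And>L M N f g. \<lbrakk>L \<in> T; N \<in> T; M \<in> mod_cat A; short_exact A L f M g N\<rbrakk> \<Longrightarrow> M \<in> T"
proof -
  note T = assms[unfolded torsion_class_def]
  show "T \<subseteq> mod_cat A" "T \<noteq> {}" using T by simp_all
  show "N \<in> T" if "M \<in> T" "N \<in> mod_cat A" "g \<in> mod_hom A M N" "g ` carrier M = carrier N" for M N g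
    by (rule T[THEN conjunct2, THEN conjunct2, THEN conjunct1, rule_format, OF that(1,2)])
      (rule bexI[OF _ that(3)], rule that(4))
  show "M \<in> T" if "L \<in> T" "N \<in> T" "M \<in> mod_cat A" "short_exact A L f M g N" for L M N f g
    by (rule T[THEN conjunct2, THEN conjunct2, THEN conjunct2, rule_format, OF that(1,2,3)])
      (rule exI exI that(4))+
qed

lemma torsion_class_zero:
  assumes "torsion_class A T" "Z \<in> mod_cat A" "carrier Z = {\<zero>\<^bsub>Z\<^esub>}"
  shows "Z \<in> T"
proof -
  obtain M where M: "M \<in> T" "M \<in> mod_cat A" using torsion_classD(1,2)[OF assms(1)] by blast
  interpret M: left_module A M using M by (simp add: mod_cat_def)
  interpret Z: left_module A Z using assms by (simp add: mod_cat_def)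
  have sm: "a \<odot>\<^bsub>Z\<^esub> \<zero>\<^bsub>Z\<^esub> = \<zero>\<^bsub>Z\<^esub>" if "a \<in> carrier A" for a
    using Z.smult_closed[OF that Z.M.zero_closed] assms(3) by auto
  have "(\<lambda>x\<in>carrier M. \<zero>\<^bsub>Z\<^esub>) \<in> mod_hom A M Z"
    by (auto simp: mod_hom_def sm)
  moreover have "(\<lambda>x\<in>carrier M. \<zero>\<^bsub>Z\<^esub>) ` carrier M = carrier Z"
    using M.M.zero_closed by (auto simp: assms(3))
  ultimately show ?thesis by (rule torsion_classD(3)[OF assms(1) M(1) assms(2)])
qed

lemma complete_lattice_tors:
  assumes "ring A"
  shows "complete_lattice (tors A)"
proof -
  obtain Z where Z: "Z \<in> mod_cat A" "carrier Z = {\<zero>\<^bsub>Z\<^esub>}"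
    using zero_module_in_mod_cat[OF assms] by blast
  interpret partial_order "tors A"
    by unfold_locales (auto simp: tors_def)
  show ?thesis
  proof (rule complete_lattice_criterion1)
    have "torsion_class A (mod_cat A)" using Z by (auto simp: torsion_class_def)
    then show "\<exists>g. greatest (tors A) g (carrier (tors A))"
      by (intro exI[of _ "mod_cat A"]) (auto simp: greatest_def tors_def dest: torsion_classD(1))
  next
    fix F assume F: "F \<subseteq> carrier (tors A)" "F \<noteq> {}"
    then have TC: "torsion_class A T" if "T \<in> F" for T using that by (auto simp: tors_def)
    have "torsion_class A (\<Inter>F)"
      unfolding torsion_class_def
    proof (intro conjI ballI impI)
      show "\<Inter>F \<subseteq> mod_cat A" using F(2) torsion_classD(1)[OF TC] by auto
      show "\<Inter>F \<noteq> {}" using torsion_class_zero[OF TC Z] by blast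
    next
      fix M N assume "M \<in> \<Inter>F" "N \<in> mod_cat A" "\<exists>g\<in>mod_hom A M N. g ` carrier M = carrier N"
      then show "N \<in> \<Inter>F" by (auto intro: torsion_classD(3)[OF TC])
    next
      fix L N M assume "L \<in> \<Inter>F" "N \<in> \<Inter>F" "M \<in> mod_cat A" "\<exists>f g. short_exact A L f M g N"
      then show "M \<in> \<Inter>F" by (auto intro: torsion_classD(4)[OF TC])
    qed
    then show "\<exists>i. greatest (tors A) i (Lower (tors A) F)"
      using F by (intro exI[of _ "\<Inter>F"]) (auto simp: greatest_def Lower_def tors_def)
  qed
qed

end

theory Submission
  imports Defs
begin

text \<open>
  If \<open>T \<subset> T'\<close> are torsion classes, a module in \<open>T'\<close> but not in \<open>T\<close> all of whose proper quotients
  lie in \<open>T\<close> is a brick that receives no non-zero morphism from \<open>T\<close>. So a chain of length \<open>r\<close>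
  yields indecomposables \<open>M\<^sub>1, \<dots>, M\<^sub>r\<close>, with all non-zero endomorphisms invertible and
  \<open>Hom(M\<^sub>j, M\<^sub>i) = 0\<close> for \<open>j < i\<close>; in particular \<open>r \<le> |ind A|\<close>. In case of equality these are
  all the indecomposables, and non-zero non-isomorphisms strictly decrease the index, which rules
  out cycles.

  Conversely, over a representation-directed algebra every indecomposable is a brick, hence brick-finite
  means representation-finite. Sorting the indecomposables topologically gives
  \<open>Hom(M\<^sub>i, M\<^sub>j) = 0\<close> for \<open>i < j\<close>, and the torsion classes \<open>{X. Hom(X, M\<^sub>j) = 0 for all j > i}\<close>
  form a chain of length \<open>|ind A|\<close>, since \<open>M\<^sub>i\<close> lies in the \<open>i\<close>-th but not in the preceding one.
\<close>

subsection \<open>Submodules and finite generation\<close>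

context left_module
begin

lemma smult_r_null [simp]: "a \<in> carrier R \<Longrightarrow> a \<odot>\<^bsub>M\<^esub> \<zero>\<^bsub>M\<^esub> = \<zero>\<^bsub>M\<^esub>"
  using smult_r_distr[of a "\<zero>\<^bsub>M\<^esub>" "\<zero>\<^bsub>M\<^esub>"] by simp

lemma smult_l_null [simp]: "x \<in> carrier M \<Longrightarrow> \<zero> \<odot>\<^bsub>M\<^esub> x = \<zero>\<^bsub>M\<^esub>"
  using smult_l_distr[of \<zero> \<zero> x] by simp

lemma smult_r_minus:
  assumes "a \<in> carrier R" "x \<in> carrier M"
  shows "a \<odot>\<^bsub>M\<^esub> (\<ominus>\<^bsub>M\<^esub> x) = \<ominus>\<^bsub>M\<^esub> (a \<odot>\<^bsub>M\<^esub> x)"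
  using smult_r_distr[OF assms(1), of "\<ominus>\<^bsub>M\<^esub> x" x] assms
  by (simp add: M.l_neg M.minus_equality)

lemma smult_l_minus:
  assumes "a \<in> carrier R" "x \<in> carrier M"
  shows "(\<ominus> a) \<odot>\<^bsub>M\<^esub> x = \<ominus>\<^bsub>M\<^esub> (a \<odot>\<^bsub>M\<^esub> x)"
  using smult_l_distr[of "\<ominus> a" a x] assms
  by (simp add: R.l_neg M.minus_equality)

lemma minus_self: "x \<in> carrier M \<Longrightarrow> x \<ominus>\<^bsub>M\<^esub> x = \<zero>\<^bsub>M\<^esub>"
  by (simp add: a_minus_def M.r_neg)

lemma minus_add_cancel:
  assumes "x \<in> carrier M" "y \<in> carrier M"
  shows "(x \<ominus>\<^bsub>M\<^esub> y) \<oplus>\<^bsub>M\<^esub> y = x"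
  using assms by (simp add: a_minus_def M.a_assoc M.l_neg)

lemma minus_eq_zero_iff:
  assumes "x \<in> carrier M" "y \<in> carrier M"
  shows "x \<ominus>\<^bsub>M\<^esub> y = \<zero>\<^bsub>M\<^esub> \<longleftrightarrow> x = y"
  using minus_add_cancel[OF assms] assms minus_self by auto

lemma smult_finsum:
  assumes "finite S" "a \<in> carrier R" "v \<in> S \<rightarrow> carrier M"
  shows "a \<odot>\<^bsub>M\<^esub> finsum M v S = (\<Oplus>\<^bsub>M\<^esub>s\<in>S. a \<odot>\<^bsub>M\<^esub> v s)"
  using assms by (induction S rule: finite_induct) (simp_all add: Pi_def smult_r_distr)

text \<open>Closure under inverses comes from the scalars, since \<open>\<ominus> \<one>\<close>
  acts as negation; this leaves closure conditions that are convenient to check.\<close>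

lemma submodule_iff:
  "submodule U R M \<longleftrightarrow> U \<subseteq> carrier M \<and> \<zero>\<^bsub>M\<^esub> \<in> U \<and>
    (\<forall>x\<in>U. \<forall>y\<in>U. x \<oplus>\<^bsub>M\<^esub> y \<in> U) \<and> (\<forall>a\<in>carrier R. \<forall>x\<in>U. a \<odot>\<^bsub>M\<^esub> x \<in> U)" (is "_ \<longleftrightarrow> ?P")
proof
  assume "submodule U R M"
  then interpret submodule U R M .
  show ?P using subset m_closed one_closed smult_closed by auto
next
  assume P: ?P
  have "\<ominus>\<^bsub>M\<^esub> x \<in> U" if "x \<in> U" for x
  proof -
    have "(\<ominus> \<one>) \<odot>\<^bsub>M\<^esub> x \<in> U" using P that by blast
    moreover have "x \<in> carrier M" using P that by blast
    ultimately show ?thesis by (simp add: smult_l_minus)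
  qed
  then show "submodule U R M"
    using P by unfold_locales (auto simp: a_inv_def[symmetric])
qed

lemma submoduleD:
  assumes "submodule U R M"
  shows "U \<subseteq> carrier M" and "\<And>x. x \<in> U \<Longrightarrow> x \<in> carrier M" and "\<zero>\<^bsub>M\<^esub> \<in> U"
    and "\<And>x y. \<lbrakk>x \<in> U; y \<in> U\<rbrakk> \<Longrightarrow> x \<oplus>\<^bsub>M\<^esub> y \<in> U"
    and "\<And>a x. \<lbrakk>a \<in> carrier R; x \<in> U\<rbrakk> \<Longrightarrow> a \<odot>\<^bsub>M\<^esub> x \<in> U"
    and "\<And>x. x \<in> U \<Longrightarrow> \<ominus>\<^bsub>M\<^esub> x \<in> U"
    and "\<And>x y. \<lbrakk>x \<in> U; y \<in> U\<rbrakk> \<Longrightarrow> x \<ominus>\<^bsub>M\<^esub> y \<in> U"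
proof -
  note P = assms[unfolded submodule_iff]
  show c: "U \<subseteq> carrier M" and "\<And>x. x \<in> U \<Longrightarrow> x \<in> carrier M" and "\<zero>\<^bsub>M\<^esub> \<in> U"
    and a: "\<And>x y. \<lbrakk>x \<in> U; y \<in> U\<rbrakk> \<Longrightarrow> x \<oplus>\<^bsub>M\<^esub> y \<in> U"
    and s: "\<And>a x. \<lbrakk>a \<in> carrier R; x \<in> U\<rbrakk> \<Longrightarrow> a \<odot>\<^bsub>M\<^esub> x \<in> U"
    using P by auto
  show n: "\<ominus>\<^bsub>M\<^esub> x \<in> U" if "x \<in> U" for x
    using s[of "\<ominus> \<one>" x] that c smult_l_minus[of \<one> x] by auto
  show "x \<ominus>\<^bsub>M\<^esub> y \<in> U" if "x \<in> U" "y \<in> U" for x y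
    using a n that by (simp add: a_minus_def)
qed

lemma submodule_zero: "submodule {\<zero>\<^bsub>M\<^esub>} R M"
  by (simp add: submodule_iff)

lemma submodule_carrier: "submodule (carrier M) R M"
  by (simp add: submodule_iff)

lemma left_module_submodule:
  assumes "submodule U R M"
  shows "left_module R (M\<lparr>carrier := U\<rparr>)"
proof -
  note U = submoduleD[OF assms]
  have "abelian_group (M\<lparr>carrier := U\<rparr>)"
  proof (rule abelian_groupI)
    fix x assume "x \<in> carrier (M\<lparr>carrier := U\<rparr>)"
    then show "\<exists>y\<in>carrier (M\<lparr>carrier := U\<rparr>). y \<oplus>\<^bsub>M\<lparr>carrier := U\<rparr>\<^esub> x = \<zero>\<^bsub>M\<lparr>carrier := U\<rparr>\<^esub>"
      using U by (intro bexI[of _ "\<ominus>\<^bsub>M\<^esub> x"]) (auto simp: M.l_neg)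
  qed (use U in \<open>auto simp: M.a_ac\<close>)
  moreover have "left_module_axioms R (M\<lparr>carrier := U\<rparr>)"
    using U by unfold_locales (auto simp: smult_l_distr smult_r_distr smult_assoc1)
  ultimately show ?thesis by (intro left_module.intro R.ring_axioms)
qed

lemma submodule_finsum_closed:
  assumes "submodule U R M" "finite S" "v \<in> S \<rightarrow> U"
  shows "finsum M v S \<in> U"
  using assms(2,3)
proof (induction S rule: finite_induct)
  case empty
  then show ?case using submoduleD[OF assms(1)] by simp
next
  case (insert x F)
  then have "v \<in> F \<rightarrow> carrier M" "v x \<in> carrier M" using submoduleD[OF assms(1)] by auto
  then show ?case using insert submoduleD[OF assms(1)] by (simp add: M.finsum_insert)
qed

text \<open>The linear combinations of \<open>S\<close> form the smallest submodule containing
  \<open>S\<close>. Generation can thus be tested on submodules, which pull back along homomorphisms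
  more easily than coefficients.\<close>

lemma finitely_generated_iff:
  "finitely_generated R M \<longleftrightarrow>
    (\<exists>S. finite S \<and> S \<subseteq> carrier M \<and> (\<forall>U. submodule U R M \<and> S \<subseteq> U \<longrightarrow> U = carrier M))"
proof
  assume "finitely_generated R M"
  then obtain S where S: "finite S" "S \<subseteq> carrier M"
    "carrier M = {(\<Oplus>\<^bsub>M\<^esub>s\<in>S. c s \<odot>\<^bsub>M\<^esub> s) | c. c \<in> S \<rightarrow> carrier R}"
    unfolding finitely_generated_def by blast
  have "U = carrier M" if U: "submodule U R M" "S \<subseteq> U" for U
  proof
    show "U \<subseteq> carrier M" using submoduleD[OF U(1)] by blast
    have "(\<Oplus>\<^bsub>M\<^esub>s\<in>S. c s \<odot>\<^bsub>M\<^esub> s) \<in> U" if "c \<in> S \<rightarrow> carrier R" for c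
      using that U(2) submoduleD(5)[OF U(1)]
      by (intro submodule_finsum_closed U(1) S(1)) (auto simp: Pi_iff subset_iff)
    then show "carrier M \<subseteq> U" by (subst S(3)) auto
  qed
  then show "\<exists>S. finite S \<and> S \<subseteq> carrier M \<and> (\<forall>U. submodule U R M \<and> S \<subseteq> U \<longrightarrow> U = carrier M)"
    using S(1,2) by blast
next
  assume "\<exists>S. finite S \<and> S \<subseteq> carrier M \<and> (\<forall>U. submodule U R M \<and> S \<subseteq> U \<longrightarrow> U = carrier M)"
  then obtain S where S: "finite S" "S \<subseteq> carrier M"
    "\<And>U. submodule U R M \<Longrightarrow> S \<subseteq> U \<Longrightarrow> U = carrier M" by auto
  define G where "G = {(\<Oplus>\<^bsub>M\<^esub>s\<in>S. c s \<odot>\<^bsub>M\<^esub> s) | c. c \<in> S \<rightarrow> carrier R}"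
  have GI: "(\<Oplus>\<^bsub>M\<^esub>s\<in>S. c s \<odot>\<^bsub>M\<^esub> s) \<in> G" if "c \<in> S \<rightarrow> carrier R" for c
    using that by (auto simp: G_def)
  have cl: "(\<lambda>s. c s \<odot>\<^bsub>M\<^esub> s) \<in> S \<rightarrow> carrier M" if "c \<in> S \<rightarrow> carrier R" for c
    using that S(2) by auto
  have "submodule G R M"
    unfolding submodule_iff
  proof (intro conjI ballI)
    show "G \<subseteq> carrier M" using cl by (auto simp: G_def intro!: M.finsum_closed)
    have "(\<Oplus>\<^bsub>M\<^esub>s\<in>S. \<zero> \<odot>\<^bsub>M\<^esub> s) = (\<Oplus>\<^bsub>M\<^esub>s\<in>S. \<zero>\<^bsub>M\<^esub>)"
      using S(2) by (intro M.finsum_cong') auto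
    then show "\<zero>\<^bsub>M\<^esub> \<in> G" using GI[of "\<lambda>_. \<zero>"] by simp
  next
    fix x y assume "x \<in> G" "y \<in> G"
    then obtain c d where cd: "c \<in> S \<rightarrow> carrier R" "d \<in> S \<rightarrow> carrier R"
      "x = (\<Oplus>\<^bsub>M\<^esub>s\<in>S. c s \<odot>\<^bsub>M\<^esub> s)" "y = (\<Oplus>\<^bsub>M\<^esub>s\<in>S. d s \<odot>\<^bsub>M\<^esub> s)" by (auto simp: G_def)
    have "x \<oplus>\<^bsub>M\<^esub> y = (\<Oplus>\<^bsub>M\<^esub>s\<in>S. c s \<odot>\<^bsub>M\<^esub> s \<oplus>\<^bsub>M\<^esub> d s \<odot>\<^bsub>M\<^esub> s)"
      unfolding cd(3,4) using cl cd by (intro M.finsum_addf[symmetric]) auto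
    also have "\<dots> = (\<Oplus>\<^bsub>M\<^esub>s\<in>S. (c s \<oplus> d s) \<odot>\<^bsub>M\<^esub> s)"
      using cd S(2) by (intro M.finsum_cong') (auto simp: Pi_def subset_eq smult_l_distr)
    also have "\<dots> \<in> G" using cd by (intro GI) auto
    finally show "x \<oplus>\<^bsub>M\<^esub> y \<in> G" .
  next
    fix a x assume a: "a \<in> carrier R" and "x \<in> G"
    then obtain c where c: "c \<in> S \<rightarrow> carrier R" "x = (\<Oplus>\<^bsub>M\<^esub>s\<in>S. c s \<odot>\<^bsub>M\<^esub> s)"
      by (auto simp: G_def)
    have "a \<odot>\<^bsub>M\<^esub> x = (\<Oplus>\<^bsub>M\<^esub>s\<in>S. a \<odot>\<^bsub>M\<^esub> (c s \<odot>\<^bsub>M\<^esub> s))"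
      unfolding c(2) using cl c a S(1) by (intro smult_finsum) auto
    also have "\<dots> = (\<Oplus>\<^bsub>M\<^esub>s\<in>S. (a \<otimes> c s) \<odot>\<^bsub>M\<^esub> s)"
      using c a S(2) by (intro M.finsum_cong') (auto simp: Pi_def subset_eq smult_assoc1)
    also have "\<dots> \<in> G" using c a by (intro GI) auto
    finally show "a \<odot>\<^bsub>M\<^esub> x \<in> G" .
  qed
  moreover have "S \<subseteq> G"
  proof
    fix t assume t: "t \<in> S"
    \<comment> \<open>Coefficient one at \<open>t\<close> and zero elsewhere; the test is turned
      round to \<open>t = s\<close> to match \<open>finsum_singleton\<close>.\<close>
    have "(\<Oplus>\<^bsub>M\<^esub>s\<in>S. (if s = t then \<one> else \<zero>) \<odot>\<^bsub>M\<^esub> s) = (\<Oplus>\<^bsub>M\<^esub>s\<in>S. if t = s then s else \<zero>\<^bsub>M\<^esub>)"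
      using S(2) by (intro M.finsum_cong') auto
    also have "\<dots> = t" using t S by (intro M.finsum_singleton) auto
    finally show "t \<in> G" using GI[of "\<lambda>s. if s = t then \<one> else \<zero>"] by auto
  qed
  ultimately have "G = carrier M" by (rule S(3))
  then show "finitely_generated R M"
    unfolding finitely_generated_def G_def using S(1,2) by blast
qed

end

subsection \<open>Homomorphisms, images and quotients\<close>

lemma mod_homI:
  assumes "\<And>x. x \<in> carrier M \<Longrightarrow> f x \<in> carrier N"
    and "\<And>x y. \<lbrakk>x \<in> carrier M; y \<in> carrier M\<rbrakk> \<Longrightarrow> f (x \<oplus>\<^bsub>M\<^esub> y) = f x \<oplus>\<^bsub>N\<^esub> f y"
    and "\<And>a x. \<lbrakk>a \<in> carrier R; x \<in> carrier M\<rbrakk> \<Longrightarrow> f (a \<odot>\<^bsub>M\<^esub> x) = a \<odot>\<^bsub>N\<^esub> f x"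
    and "f \<in> extensional (carrier M)"
  shows "f \<in> mod_hom R M N"
  using assms by (auto simp: mod_hom_def PiE_def)

lemma mod_hom_restrictI:
  assumes "left_module R M"
    and "\<And>x. x \<in> carrier M \<Longrightarrow> f x \<in> carrier N"
    and "\<And>x y. \<lbrakk>x \<in> carrier M; y \<in> carrier M\<rbrakk> \<Longrightarrow> f (x \<oplus>\<^bsub>M\<^esub> y) = f x \<oplus>\<^bsub>N\<^esub> f y"
    and "\<And>a x. \<lbrakk>a \<in> carrier R; x \<in> carrier M\<rbrakk> \<Longrightarrow> f (a \<odot>\<^bsub>M\<^esub> x) = a \<odot>\<^bsub>N\<^esub> f x"
  shows "restrict f (carrier M) \<in> mod_hom R M N"
proof -
  interpret M: left_module R M by fact
  show ?thesis using assms(2-4) by (intro mod_homI) auto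
qed

text \<open>Restricted to the carrier because elements of \<open>mod_hom\<close> are extensional;
  this is also the form in \<open>mod_cycle\<close> and \<open>end_ring\<close>.\<close>

abbreviation zero_hom ::
    "('a, 'm, 'p) module_scheme \<Rightarrow> ('a, 'n, 'q) module_scheme \<Rightarrow> 'm \<Rightarrow> 'n"
  where "zero_hom M N \<equiv> \<lambda>x\<in>carrier M. \<zero>\<^bsub>N\<^esub>"

lemma mod_hom_eq_zero_iff:
  assumes "f \<in> mod_hom R M N"
  shows "f = zero_hom M N \<longleftrightarrow> (\<forall>x\<in>carrier M. f x = \<zero>\<^bsub>N\<^esub>)"
  using mod_homD(4)[OF assms] by (auto intro: extensionalityI)

lemma mod_hom_compose:
  assumes "left_module R L" "f \<in> mod_hom R L M" "g \<in> mod_hom R M N"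
  shows "compose (carrier L) g f \<in> mod_hom R L N"
  unfolding compose_def using mod_homD[OF assms(2)] mod_homD[OF assms(3)]
  by (intro mod_hom_restrictI[OF assms(1)]) auto

lemma mod_iso_compose:
  assumes "left_module R L" "f \<in> mod_iso R L M" "g \<in> mod_iso R M N"
  shows "compose (carrier L) g f \<in> mod_iso R L N"
  using assms mod_hom_compose[OF assms(1)] bij_betw_compose[of f "carrier L" "carrier M" g "carrier N"]
  by (auto simp: mod_iso_def)

lemma mod_iso_id:
  assumes "left_module R M"
  shows "(\<lambda>x\<in>carrier M. x) \<in> mod_iso R M M"
  using mod_hom_restrictI[OF assms, of "\<lambda>x. x" M] by (auto simp: mod_iso_def bij_betw_def inj_on_def)

lemma mod_iso_inverse:
  assumes "left_module R M" "left_module R N" "f \<in> mod_iso R M N"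
  defines "g \<equiv> restrict (inv_into (carrier M) f) (carrier N)"
  shows "g \<in> mod_iso R N M"
    and "\<And>x. x \<in> carrier M \<Longrightarrow> g (f x) = x" and "\<And>y. y \<in> carrier N \<Longrightarrow> f (g y) = y"
proof -
  interpret M: left_module R M by fact
  interpret N: left_module R N by fact
  have hom: "f \<in> mod_hom R M N" and bij: "bij_betw f (carrier M) (carrier N)"
    using assms(3) by (auto simp: mod_iso_def)
  note f = mod_homD[OF hom]
  show gf: "g (f x) = x" if "x \<in> carrier M" for x
    using that bij f(1) by (simp add: g_def bij_betw_inv_into_left)
  show fg: "f (g y) = y" if "y \<in> carrier N" for y
    using that bij by (simp add: g_def bij_betw_inv_into_right)
  have gbij: "bij_betw g (carrier N) (carrier M)"
    using bij_betw_inv_into[OF bij] by (simp add: g_def cong: bij_betw_cong)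
  then have gc: "g y \<in> carrier M" if "y \<in> carrier N" for y
    using that by (auto simp: bij_betw_def)
  have "g \<in> mod_hom R N M"
  proof (rule mod_homI)
    fix x y assume "x \<in> carrier N" "y \<in> carrier N"
    \<comment> \<open>Applying \<open>f\<close> to the right-hand side gives the sum of
      \<open>x\<close> and \<open>y\<close>, and \<open>gf\<close> then cancels
      \<open>f\<close>.\<close>
    then show "g (x \<oplus>\<^bsub>N\<^esub> y) = g x \<oplus>\<^bsub>M\<^esub> g y"
      using gf[of "g x \<oplus>\<^bsub>M\<^esub> g y"] gc by (simp add: f fg)
  next
    fix a x assume "a \<in> carrier R" "x \<in> carrier N"
    then show "g (a \<odot>\<^bsub>N\<^esub> x) = a \<odot>\<^bsub>M\<^esub> g x"
      using gf[of "a \<odot>\<^bsub>M\<^esub> g x"] gc by (simp add: f fg)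
  qed (use gc in \<open>auto simp: g_def\<close>)
  then show "g \<in> mod_iso R N M" using gbij by (simp add: mod_iso_def)
qed

lemma mod_hom_minus:
  assumes "left_module R M" "left_module R N" "f \<in> mod_hom R M N"
    and "x \<in> carrier M" "y \<in> carrier M"
  shows "f (x \<ominus>\<^bsub>M\<^esub> y) = f x \<ominus>\<^bsub>N\<^esub> f y"
proof -
  interpret M: left_module R M by fact
  interpret N: left_module R N by fact
  note f = mod_homD[OF assms(3)]
  have "f (\<ominus>\<^bsub>M\<^esub> y) \<oplus>\<^bsub>N\<^esub> f y = \<zero>\<^bsub>N\<^esub>"
    using f(2)[of "\<ominus>\<^bsub>M\<^esub> y" y] assms(5) mod_hom_zero[OF assms(1-3)] by (simp add: M.M.l_neg)
  then have "f (\<ominus>\<^bsub>M\<^esub> y) = \<ominus>\<^bsub>N\<^esub> f y" using assms(5) f(1) by (simp add: N.M.minus_equality)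
  then show ?thesis using assms(4,5) f by (simp add: a_minus_def)
qed

lemma inj_on_mod_homI:
  assumes "left_module R M" "left_module R N" "f \<in> mod_hom R M N"
    and "\<And>x. \<lbrakk>x \<in> carrier M; f x = \<zero>\<^bsub>N\<^esub>\<rbrakk> \<Longrightarrow> x = \<zero>\<^bsub>M\<^esub>"
  shows "inj_on f (carrier M)"
proof (rule inj_onI)
  interpret M: left_module R M by fact
  interpret N: left_module R N by fact
  fix x y assume xy: "x \<in> carrier M" "y \<in> carrier M" "f x = f y"
  then have "f (x \<ominus>\<^bsub>M\<^esub> y) = \<zero>\<^bsub>N\<^esub>"
    unfolding mod_hom_minus[OF assms(1-3) xy(1,2)] xy(3)
    using mod_homD(1)[OF assms(3) xy(2)] by (simp add: N.minus_self)
  then have "x \<ominus>\<^bsub>M\<^esub> y = \<zero>\<^bsub>M\<^esub>" using assms(4) xy by simp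
  then show "x = y" using xy by (simp add: M.minus_eq_zero_iff)
qed

lemma submodule_vimage:
  assumes "left_module R M" "left_module R N" "f \<in> mod_hom R M N" "submodule V R N"
  shows "submodule {x \<in> carrier M. f x \<in> V} R M"
proof -
  interpret M: left_module R M by fact
  interpret N: left_module R N by fact
  show ?thesis
    using mod_homD[OF assms(3)] N.submoduleD[OF assms(4)] mod_hom_zero[OF assms(1-3)]
    by (auto simp: M.submodule_iff)
qed

lemma submodule_kernel:
  assumes "left_module R M" "left_module R N" "f \<in> mod_hom R M N"
  shows "submodule {x \<in> carrier M. f x = \<zero>\<^bsub>N\<^esub>} R M"
  using submodule_vimage[OF assms left_module.submodule_zero[OF assms(2)]] by simp

lemma submodule_image:
  assumes "left_module R M" "left_module R N" "f \<in> mod_hom R M N" "submodule U R M"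
  shows "submodule (f ` U) R N"
proof -
  interpret M: left_module R M by fact
  interpret N: left_module R N by fact
  note f = mod_homD[OF assms(3)] and U = M.submoduleD[OF assms(4)]
  show ?thesis
    unfolding N.submodule_iff
  proof (intro conjI ballI)
    show "f ` U \<subseteq> carrier N" using f U by auto
    show "\<zero>\<^bsub>N\<^esub> \<in> f ` U"
      using U(3) mod_hom_zero[OF assms(1-3)] by (metis imageI)
  next
    fix x y assume "x \<in> f ` U" "y \<in> f ` U"
    then show "x \<oplus>\<^bsub>N\<^esub> y \<in> f ` U" using U f by (auto simp flip: f(2))
  next
    fix a x assume "a \<in> carrier R" "x \<in> f ` U"
    then show "a \<odot>\<^bsub>N\<^esub> x \<in> f ` U" using U f by (auto simp flip: f(3))
  qed
qed

text \<open>The images of the generators generate: the preimage of a submodule containing them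
  contains all generators of \<open>M\<close>, hence is everything.\<close>

lemma finitely_generated_surj:
  assumes "left_module R M" "left_module R N" "f \<in> mod_hom R M N" "f ` carrier M = carrier N"
    and "finitely_generated R M"
  shows "finitely_generated R N"
proof -
  interpret M: left_module R M by fact
  interpret N: left_module R N by fact
  obtain S where S: "finite S" "S \<subseteq> carrier M"
    "\<And>U. submodule U R M \<Longrightarrow> S \<subseteq> U \<Longrightarrow> U = carrier M"
    using assms(5) unfolding M.finitely_generated_iff by auto
  have "V = carrier N" if V: "submodule V R N" "f ` S \<subseteq> V" for V
  proof -
    have "{x \<in> carrier M. f x \<in> V} = carrier M"
      using S(2) V(2) by (intro S(3) submodule_vimage[OF assms(1-3) V(1)]) auto
    then have "f ` carrier M \<subseteq> V" by blast
    then show ?thesis unfolding assms(4) using N.submoduleD(1)[OF V(1)] by (rule equalityI[rotated])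
  qed
  then show ?thesis
    unfolding N.finitely_generated_iff using S(1,2) assms(4) by (intro exI[of _ "f ` S"]) auto
qed

section \<open>Images and quotients as objects of \<open>mod_cat A\<close>, and
  factorisation\<close>

lemma mod_catD: "M \<in> mod_cat A \<Longrightarrow> left_module A M"
  by (simp add: mod_cat_def)

text \<open>The image inherits finite generation as a factor of \<open>L\<close>, so it is again an
  object and can be tested for membership in torsion classes.\<close>

lemma mod_hom_onto_image:
  assumes "L \<in> mod_cat A" "M \<in> mod_cat A" "f \<in> mod_hom A L M"
  shows "M\<lparr>carrier := f ` carrier L\<rparr> \<in> mod_cat A"
    and "f \<in> mod_hom A L (M\<lparr>carrier := f ` carrier L\<rparr>)"
    and "submodule (f ` carrier L) A M"
proof -
  note LM = mod_catD[OF assms(1)] mod_catD[OF assms(2)]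
  show sub: "submodule (f ` carrier L) A M"
    by (rule submodule_image[OF LM assms(3) left_module.submodule_carrier[OF LM(1)]])
  show hom: "f \<in> mod_hom A L (M\<lparr>carrier := f ` carrier L\<rparr>)"
    using mod_homD[OF assms(3)] by (intro mod_homI) auto
  note lm = left_module.left_module_submodule[OF LM(2) sub]
  show "M\<lparr>carrier := f ` carrier L\<rparr> \<in> mod_cat A"
    using finitely_generated_surj[OF LM(1) lm hom] assms(1) lm by (simp add: mod_cat_def)
qed

lemma mod_hom_inclusion:
  assumes "left_module R M" "submodule U R M"
  shows "(\<lambda>x\<in>U. x) \<in> mod_hom R (M\<lparr>carrier := U\<rparr>) M"
  using left_module.submoduleD[OF assms] by (intro mod_homI) auto

text \<open>Cosets would have the wrong type for \<open>mod_cat\<close>, so the quotient is carried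
  by a set of representatives inside \<open>M\<close>, and each operation of \<open>M\<close> is
  followed by a return to the representative.\<close>

lemma quotient_in_mod_cat:
  fixes A :: "('a, 'r) ring_scheme"
  assumes "M \<in> mod_cat A" "submodule U A M"
  obtains Q p where "Q \<in> mod_cat A" "p \<in> mod_hom A M Q" "p ` carrier M = carrier Q"
    "{x \<in> carrier M. p x = \<zero>\<^bsub>Q\<^esub>} = U"
proof -
  interpret M: left_module A M using assms(1) by (rule mod_catD)
  note U = M.submoduleD[OF assms(2)]
  define r where "r = (\<lambda>x\<in>carrier M. SOME y. y \<in> carrier M \<and> x \<ominus>\<^bsub>M\<^esub> y \<in> U)"
  have r: "r x \<in> carrier M" "x \<ominus>\<^bsub>M\<^esub> r x \<in> U" if "x \<in> carrier M" for x
  proof -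
    have "x \<in> carrier M \<and> x \<ominus>\<^bsub>M\<^esub> x \<in> U" using that U(3) by (simp add: M.minus_self)
    from someI[of "\<lambda>y. y \<in> carrier M \<and> x \<ominus>\<^bsub>M\<^esub> y \<in> U", OF this]
    show "r x \<in> carrier M" "x \<ominus>\<^bsub>M\<^esub> r x \<in> U" using that by (simp_all add: r_def)
  qed
  have sym: "y \<ominus>\<^bsub>M\<^esub> x \<in> U" if "x \<in> carrier M" "y \<in> carrier M" "x \<ominus>\<^bsub>M\<^esub> y \<in> U" for x y
    using U(6)[OF that(3)] that(1,2) by (simp add: a_minus_def M.M.minus_add M.M.a_comm)
  have trans: "x \<ominus>\<^bsub>M\<^esub> z \<in> U"
    if "x \<in> carrier M" "y \<in> carrier M" "z \<in> carrier M" "x \<ominus>\<^bsub>M\<^esub> y \<in> U" "y \<ominus>\<^bsub>M\<^esub> z \<in> U" for x y z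
    using U(4)[OF that(4,5)] that(1-3) by (simp add: a_minus_def M.M.a_assoc M.M.r_neg1)
  have r_eq: "r x = r y \<longleftrightarrow> x \<ominus>\<^bsub>M\<^esub> y \<in> U" if xy: "x \<in> carrier M" "y \<in> carrier M" for x y
  proof
    assume "r x = r y"
    then show "x \<ominus>\<^bsub>M\<^esub> y \<in> U" using r[OF xy(1)] r[OF xy(2)] xy by (metis sym trans)
  next
    assume "x \<ominus>\<^bsub>M\<^esub> y \<in> U"
    \<comment> \<open>Congruent elements satisfy the same predicate, so \<open>SOME\<close> returns
      the same representative for both.\<close>
    then have "x \<ominus>\<^bsub>M\<^esub> z \<in> U \<longleftrightarrow> y \<ominus>\<^bsub>M\<^esub> z \<in> U" if "z \<in> carrier M" for z
      using that xy by (meson sym trans)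
    then have "(z \<in> carrier M \<and> x \<ominus>\<^bsub>M\<^esub> z \<in> U) = (z \<in> carrier M \<and> y \<ominus>\<^bsub>M\<^esub> z \<in> U)" for z
      by blast
    then show "r x = r y" using xy by (simp add: r_def)
  qed
  have radd: "r (r x \<oplus>\<^bsub>M\<^esub> r y) = r (x \<oplus>\<^bsub>M\<^esub> y)" if xy: "x \<in> carrier M" "y \<in> carrier M" for x y
  proof -
    have "(x \<oplus>\<^bsub>M\<^esub> y) \<ominus>\<^bsub>M\<^esub> (r x \<oplus>\<^bsub>M\<^esub> r y) = (x \<ominus>\<^bsub>M\<^esub> r x) \<oplus>\<^bsub>M\<^esub> (y \<ominus>\<^bsub>M\<^esub> r y)"
      using r(1) xy by (simp add: a_minus_def M.M.minus_add M.M.a_ac)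
    also have "\<dots> \<in> U" using r xy U(4) by simp
    finally show ?thesis using r(1) xy by (metis r_eq M.M.a_closed)
  qed
  have rsm: "r (a \<odot>\<^bsub>M\<^esub> r x) = r (a \<odot>\<^bsub>M\<^esub> x)" if "a \<in> carrier A" "x \<in> carrier M" for a x
  proof -
    have "a \<odot>\<^bsub>M\<^esub> x \<ominus>\<^bsub>M\<^esub> a \<odot>\<^bsub>M\<^esub> r x = a \<odot>\<^bsub>M\<^esub> (x \<ominus>\<^bsub>M\<^esub> r x)"
      using r(1) that by (simp add: a_minus_def M.smult_r_distr M.smult_r_minus)
    also have "\<dots> \<in> U" using r that U(5) by simp
    finally show ?thesis using r(1) that by (metis r_eq M.smult_closed)
  qed
  define Q :: "('a, 'a list) module" where
    "Q = \<lparr>carrier = r ` carrier M, mult = (\<lambda>u v. u), one = r \<zero>\<^bsub>M\<^esub>, zero = r \<zero>\<^bsub>M\<^esub>,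
      add = (\<lambda>u v. r (u \<oplus>\<^bsub>M\<^esub> v)), smult = (\<lambda>a u. r (a \<odot>\<^bsub>M\<^esub> u))\<rparr>"
  have rr: "r (r x) = r x" if "x \<in> carrier M" for x
    using r[OF that] that by (metis r_eq)
  have radd1: "r (r x \<oplus>\<^bsub>M\<^esub> y) = r (x \<oplus>\<^bsub>M\<^esub> y)" "r (x \<oplus>\<^bsub>M\<^esub> r y) = r (x \<oplus>\<^bsub>M\<^esub> y)"
    if "x \<in> carrier M" "y \<in> carrier M" for x y
    using radd[of "r x" y] radd[of x "r y"] radd[OF that] that rr r(1) by auto
  have "abelian_group Q"
  proof (rule abelian_groupI)
    fix x assume "x \<in> carrier Q"
    then obtain u where "u \<in> carrier M" "x = r u" by (auto simp: Q_def)
    then show "\<exists>y\<in>carrier Q. y \<oplus>\<^bsub>Q\<^esub> x = \<zero>\<^bsub>Q\<^esub>"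
      by (intro bexI[of _ "r (\<ominus>\<^bsub>M\<^esub> u)"]) (auto simp: Q_def radd1 r M.M.l_neg)
  qed (auto simp: Q_def radd1 rr r, auto simp: M.M.a_ac)
  moreover have "left_module_axioms A Q"
    by unfold_locales
      (auto simp: Q_def radd1 rsm rr r, auto simp: M.smult_l_distr M.smult_r_distr M.smult_assoc1)
  ultimately have lm: "left_module A Q" by (intro left_module.intro M.R.ring_axioms)
  have hom: "r \<in> mod_hom A M Q"
    by (intro mod_homI) (auto simp: Q_def radd1 rsm r, auto simp: r_def)
  have surj: "r ` carrier M = carrier Q" by (simp add: Q_def)
  have "Q \<in> mod_cat A"
    using finitely_generated_surj[OF M.left_module_axioms lm hom surj] assms(1) lm
    by (simp add: mod_cat_def)
  moreover have "{x \<in> carrier M. r x = \<zero>\<^bsub>Q\<^esub>} = U"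
  proof -
    have "r x = r \<zero>\<^bsub>M\<^esub> \<longleftrightarrow> x \<in> U" if "x \<in> carrier M" for x
      using that r_eq[OF that M.M.zero_closed] M.minus_add_cancel[OF that M.M.zero_closed] by simp
    then show ?thesis using U(1) by (auto simp: Q_def)
  qed
  ultimately show ?thesis using that hom surj by blast
qed

text \<open>Elements with the same image under \<open>g\<close> differ by an element of its kernel,
  which \<open>h\<close> kills, so \<open>h\<close> is constant on the fibres of
  \<open>g\<close>.\<close>

lemma mod_hom_factor:
  assumes "left_module R M" "left_module R N" "left_module R Y"
    and "g \<in> mod_hom R M N" "g ` carrier M = carrier N" "h \<in> mod_hom R M Y"
    and ker: "\<And>x. \<lbrakk>x \<in> carrier M; g x = \<zero>\<^bsub>N\<^esub>\<rbrakk> \<Longrightarrow> h x = \<zero>\<^bsub>Y\<^esub>"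
  obtains k where "k \<in> mod_hom R N Y" "\<And>x. x \<in> carrier M \<Longrightarrow> k (g x) = h x"
proof -
  interpret M: left_module R M by fact
  interpret N: left_module R N by fact
  interpret Y: left_module R Y by fact
  note g = mod_homD[OF assms(4)] and h = mod_homD[OF assms(6)]
  have eq: "h x = h y" if "x \<in> carrier M" "y \<in> carrier M" "g x = g y" for x y
  proof -
    have "g (x \<ominus>\<^bsub>M\<^esub> y) = \<zero>\<^bsub>N\<^esub>"
      unfolding mod_hom_minus[OF assms(1,2,4) that(1,2)] that(3)
      using that g(1) by (simp add: N.minus_self)
    then have "h x \<ominus>\<^bsub>Y\<^esub> h y = \<zero>\<^bsub>Y\<^esub>"
      using ker[of "x \<ominus>\<^bsub>M\<^esub> y"] that by (simp add: mod_hom_minus[OF assms(1,3,6)])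
    then show ?thesis using that h(1) by (simp add: Y.minus_eq_zero_iff)
  qed
  define k where "k = (\<lambda>y\<in>carrier N. h (inv_into (carrier M) g y))"
  have kg: "k (g x) = h x" if "x \<in> carrier M" for x
  proof -
    have "g x \<in> g ` carrier M" using that by simp
    from eq[OF inv_into_into[OF this] that f_inv_into_f[OF this]]
    have "h (inv_into (carrier M) g (g x)) = h x" .
    moreover have "k (g x) = h (inv_into (carrier M) g (g x))"
      unfolding k_def by (rule restrict_apply') (rule g(1)[OF that])
    ultimately show ?thesis by simp
  qed
  have "k \<in> mod_hom R N Y"
  proof (rule mod_homI)
    fix x assume "x \<in> carrier N"
    then obtain u where "u \<in> carrier M" "x = g u" using assms(5) by blast
    then show "k x \<in> carrier Y" by (simp add: kg h(1))
  next
    fix x y assume "x \<in> carrier N" "y \<in> carrier N"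
    then obtain u v where "u \<in> carrier M" "v \<in> carrier M" "x = g u" "y = g v"
      using assms(5) by blast
    then show "k (x \<oplus>\<^bsub>N\<^esub> y) = k x \<oplus>\<^bsub>Y\<^esub> k y"
      by (simp add: kg h(2) flip: g(2))
  next
    fix a x assume "a \<in> carrier R" "x \<in> carrier N"
    moreover then obtain u where "u \<in> carrier M" "x = g u" using assms(5) by blast
    ultimately show "k (a \<odot>\<^bsub>N\<^esub> x) = a \<odot>\<^bsub>Y\<^esub> k x"
      by (simp add: kg h(3) flip: g(3))
  qed (simp add: k_def)
  then show ?thesis using kg by (rule that)
qed

subsection \<open>Chain conditions\<close>

text \<open>
  A finite generating set filters the space by subspaces \<open>U\<close> with factors of dimension at most
  one, and \<open>\<mu> W\<close> counts the steps of the filtration at which the intersection with \<open>W\<close> grows.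
  This stands in for the dimension.
\<close>

lemma ex_submodule_size_on:
  assumes "field K" "left_module K V" "finite F" "F \<subseteq> carrier V"
  shows "\<exists>U \<mu>. submodule U K V \<and> F \<subseteq> U \<and>
    (\<forall>W W'. submodule W K V \<and> submodule W' K V \<and> W \<subseteq> W' \<longrightarrow>
      \<mu> W \<le> (\<mu> W' :: nat) \<and> (W \<inter> U \<noteq> W' \<inter> U \<longrightarrow> \<mu> W < \<mu> W'))"
  using assms(3,4)
proof (induction F rule: finite_induct)
  case empty
  interpret V: left_module K V by fact
  show ?case
  \<comment> \<open>All submodules meet the zero subspace in zero, so the constant size zero
    serves.\<close>
  proof (rule exI[of _ "{\<zero>\<^bsub>V\<^esub>}"], rule exI[of _ "\<lambda>_. 0"], intro conjI allI impI)
    fix W W' assume "submodule W K V \<and> submodule W' K V \<and> W \<subseteq> W'"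
      and ne: "W \<inter> {\<zero>\<^bsub>V\<^esub>} \<noteq> W' \<inter> {\<zero>\<^bsub>V\<^esub>}"
    then have "\<zero>\<^bsub>V\<^esub> \<in> W" "\<zero>\<^bsub>V\<^esub> \<in> W'" using V.submoduleD(3) by blast+
    then show "(0::nat) < 0" using ne by blast
  qed (simp_all add: V.submodule_zero)
next
  case (insert v F)
  interpret K: field K by fact
  interpret V: left_module K V by fact
  have "F \<subseteq> carrier V" using insert.prems by simp
  from insert.IH[OF this] obtain U \<mu> where U: "submodule U K V" "F \<subseteq> U"
    and size: "\<forall>W W'. submodule W K V \<and> submodule W' K V \<and> W \<subseteq> W' \<longrightarrow>
      \<mu> W \<le> (\<mu> W' :: nat) \<and> (W \<inter> U \<noteq> W' \<inter> U \<longrightarrow> \<mu> W < \<mu> W')"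
    by (elim exE conjE) simp
  have mono: "\<mu> W \<le> \<mu> W'" if "submodule W K V" "submodule W' K V" "W \<subseteq> W'" for W W'
    using size that by simp
  have strict: "\<mu> W < \<mu> W'"
    if "submodule W K V" "submodule W' K V" "W \<subseteq> W'" "W \<inter> U \<noteq> W' \<inter> U" for W W'
    using size that by simp
  note u = V.submoduleD[OF U(1)]
  have v: "v \<in> carrier V" using insert.prems by simp
  define U' where "U' = {u \<oplus>\<^bsub>V\<^esub> c \<odot>\<^bsub>V\<^esub> v | u c. u \<in> U \<and> c \<in> carrier K}"
  \<comment> \<open>One more is counted once \<open>W\<close> meets \<open>U'\<close> outside
    \<open>U\<close>: this is the filtration step contributed by \<open>v\<close>.\<close>
  define \<mu>' where "\<mu>' = (\<lambda>W. \<mu> W + (if W \<inter> U' \<subseteq> U then 0 else 1))"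
  have U'I: "u \<oplus>\<^bsub>V\<^esub> c \<odot>\<^bsub>V\<^esub> v \<in> U'" if "u \<in> U" "c \<in> carrier K" for u c
    using that by (auto simp: U'_def)
  have "submodule U' K V"
    unfolding V.submodule_iff
  proof (intro conjI ballI)
    show "U' \<subseteq> carrier V" using u v by (auto simp: U'_def)
    show "\<zero>\<^bsub>V\<^esub> \<in> U'" using U'I[of "\<zero>\<^bsub>V\<^esub>" "\<zero>\<^bsub>K\<^esub>"] u v by simp
  next
    fix x y assume "x \<in> U'" "y \<in> U'"
    then obtain a b c d where *: "x = a \<oplus>\<^bsub>V\<^esub> c \<odot>\<^bsub>V\<^esub> v" "y = b \<oplus>\<^bsub>V\<^esub> d \<odot>\<^bsub>V\<^esub> v" "a \<in> U" "b \<in> U"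
      "c \<in> carrier K" "d \<in> carrier K" by (auto simp: U'_def)
    then have "x \<oplus>\<^bsub>V\<^esub> y = (a \<oplus>\<^bsub>V\<^esub> b) \<oplus>\<^bsub>V\<^esub> (c \<oplus>\<^bsub>K\<^esub> d) \<odot>\<^bsub>V\<^esub> v"
      using u(2) v by (simp add: V.smult_l_distr V.M.a_ac)
    then show "x \<oplus>\<^bsub>V\<^esub> y \<in> U'" using * u(4) U'I by simp
  next
    fix k x assume k: "k \<in> carrier K" and "x \<in> U'"
    then obtain a c where *: "x = a \<oplus>\<^bsub>V\<^esub> c \<odot>\<^bsub>V\<^esub> v" "a \<in> U" "c \<in> carrier K"
      by (auto simp: U'_def)
    then have "k \<odot>\<^bsub>V\<^esub> x = k \<odot>\<^bsub>V\<^esub> a \<oplus>\<^bsub>V\<^esub> (k \<otimes>\<^bsub>K\<^esub> c) \<odot>\<^bsub>V\<^esub> v"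
      using u(2) v k by (simp add: V.smult_r_distr V.smult_assoc1)
    then show "k \<odot>\<^bsub>V\<^esub> x \<in> U'" using * u(5) k U'I by simp
  qed
  moreover have "insert v F \<subseteq> U'"
  proof -
    have "x \<in> U'" if "x \<in> F" for x
    proof -
      have "x \<in> U" using that U(2) by blast
      then show ?thesis using U'I[of x "\<zero>\<^bsub>K\<^esub>"] u(2) v by simp
    qed
    moreover have "v \<in> U'" using U'I[OF u(3), of "\<one>\<^bsub>K\<^esub>"] v by simp
    ultimately show ?thesis by blast
  qed
  moreover have "\<mu>' W \<le> \<mu>' W' \<and> (W \<inter> U' \<noteq> W' \<inter> U' \<longrightarrow> \<mu>' W < \<mu>' W')"
    if W: "submodule W K V" "submodule W' K V" "W \<subseteq> W'" for W W'
  proof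
    show "\<mu>' W \<le> \<mu>' W'" using mono[OF W] W(3) by (auto simp: \<mu>'_def)
    show "W \<inter> U' \<noteq> W' \<inter> U' \<longrightarrow> \<mu>' W < \<mu>' W'"
    proof
      assume "W \<inter> U' \<noteq> W' \<inter> U'"
      then obtain x where x: "x \<in> W'" "x \<in> U'" "x \<notin> W" using W(3) by blast
      show "\<mu>' W < \<mu>' W'"
      proof (cases "W \<inter> U = W' \<inter> U")
        case False
        then show ?thesis using strict[OF W] W(3) by (auto simp: \<mu>'_def)
      next
        case True
        then have "x \<notin> U" using x by blast
        \<comment> \<open>An element \<open>y\<close> of \<open>W\<close> in \<open>U'\<close> but
          not in \<open>U\<close> has an invertible \<open>v\<close>-coefficient \<open>d\<close>.
          Subtracting the multiple of \<open>y\<close> that cancels the \<open>v\<close>-coefficient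
          of \<open>x\<close> lands in \<open>W' \<inter> U\<close>, which equals
          \<open>W \<inter> U\<close>, so \<open>x\<close> would be in \<open>W\<close>.\<close>
        moreover have "W \<inter> U' \<subseteq> U"
        proof (rule ccontr)
          assume "\<not> W \<inter> U' \<subseteq> U"
          then obtain y where y: "y \<in> W" "y \<in> U'" "y \<notin> U" by blast
          obtain a b c d where *: "x = a \<oplus>\<^bsub>V\<^esub> c \<odot>\<^bsub>V\<^esub> v" "y = b \<oplus>\<^bsub>V\<^esub> d \<odot>\<^bsub>V\<^esub> v"
            "a \<in> U" "b \<in> U" "c \<in> carrier K" "d \<in> carrier K"
            using x(2) y(2) by (auto simp: U'_def)
          have car: "a \<in> carrier V" "b \<in> carrier V" using * u(2) by auto
          have "d \<noteq> \<zero>\<^bsub>K\<^esub>" using y(3) * car v by auto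
          then have d: "d \<in> Units K" using *(6) K.field_Units by simp
          define e where "e = c \<otimes>\<^bsub>K\<^esub> inv\<^bsub>K\<^esub> d"
          have e: "e \<in> carrier K" "e \<otimes>\<^bsub>K\<^esub> d = c"
            using d *(5) by (simp_all add: e_def K.m_assoc K.Units_closed K.Units_l_inv)
          have "e \<odot>\<^bsub>V\<^esub> y = e \<odot>\<^bsub>V\<^esub> b \<oplus>\<^bsub>V\<^esub> c \<odot>\<^bsub>V\<^esub> v"
            unfolding *(2) using e *(6) car v V.smult_assoc1[of e d v] by (simp add: V.smult_r_distr)
          then have "x \<ominus>\<^bsub>V\<^esub> e \<odot>\<^bsub>V\<^esub> y = (a \<oplus>\<^bsub>V\<^esub> c \<odot>\<^bsub>V\<^esub> v) \<ominus>\<^bsub>V\<^esub> (e \<odot>\<^bsub>V\<^esub> b \<oplus>\<^bsub>V\<^esub> c \<odot>\<^bsub>V\<^esub> v)"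
            using *(1) by simp
          also have "\<dots> = a \<ominus>\<^bsub>V\<^esub> e \<odot>\<^bsub>V\<^esub> b"
          proof -
            have "c \<odot>\<^bsub>V\<^esub> v \<in> carrier V" "e \<odot>\<^bsub>V\<^esub> b \<in> carrier V" using *(5) v e car by auto
            then have "(a \<oplus>\<^bsub>V\<^esub> c \<odot>\<^bsub>V\<^esub> v) \<ominus>\<^bsub>V\<^esub> (e \<odot>\<^bsub>V\<^esub> b \<oplus>\<^bsub>V\<^esub> c \<odot>\<^bsub>V\<^esub> v) =
                (a \<ominus>\<^bsub>V\<^esub> e \<odot>\<^bsub>V\<^esub> b) \<oplus>\<^bsub>V\<^esub> (c \<odot>\<^bsub>V\<^esub> v \<ominus>\<^bsub>V\<^esub> c \<odot>\<^bsub>V\<^esub> v)"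
              using car by (simp add: a_minus_def V.M.minus_add V.M.a_ac)
            then show ?thesis
              using \<open>c \<odot>\<^bsub>V\<^esub> v \<in> carrier V\<close> \<open>e \<odot>\<^bsub>V\<^esub> b \<in> carrier V\<close> car
              by (simp add: a_minus_def V.M.r_neg)
          qed
          also have "\<dots> \<in> U" using * e u(5,7) by simp
          finally have "x \<ominus>\<^bsub>V\<^esub> e \<odot>\<^bsub>V\<^esub> y \<in> U" .
          moreover have eyW: "e \<odot>\<^bsub>V\<^esub> y \<in> W" using V.submoduleD(5)[OF W(1)] e y by simp
          then have "x \<ominus>\<^bsub>V\<^esub> e \<odot>\<^bsub>V\<^esub> y \<in> W'" using V.submoduleD(7)[OF W(2)] W(3) x by blast
          ultimately have "x \<ominus>\<^bsub>V\<^esub> e \<odot>\<^bsub>V\<^esub> y \<in> W" using True by blast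
          then have "(x \<ominus>\<^bsub>V\<^esub> e \<odot>\<^bsub>V\<^esub> y) \<oplus>\<^bsub>V\<^esub> e \<odot>\<^bsub>V\<^esub> y \<in> W"
            using V.submoduleD(4)[OF W(1)] eyW by blast
          moreover have "x \<in> carrier V" "e \<odot>\<^bsub>V\<^esub> y \<in> carrier V"
            using V.submoduleD(2)[OF W(1)] V.submoduleD(2)[OF W(2)] x eyW by blast+
          ultimately have "x \<in> W" by (simp add: V.minus_add_cancel)
          then show False using x by blast
        qed
        ultimately show ?thesis
          using x mono[OF W] by (auto simp: \<mu>'_def)
      qed
    qed
  qed
  ultimately show ?case
    by (intro exI[of _ U'] exI[of _ \<mu>']) simp
qed

section \<open>Modules over a finite dimensional algebra satisfy the chain conditions\<close>

context fin_dim_algebra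
begin

lemma left_module_K_A: "left_module K A"
  by unfold_locales (auto simp: smult_l_distr smult_r_distr smult_assoc1)

text \<open>Restriction of scalars along \<open>c \<mapsto> c \<cdot> 1\<close>.\<close>

definition scal :: "('a, 'm, 'n) module_scheme \<Rightarrow> ('k, 'm) module" where
  "scal M = \<lparr>carrier = carrier M, mult = mult M, one = one M, zero = zero M, add = add M,
    smult = (\<lambda>c x. (c \<odot>\<^bsub>A\<^esub> \<one>\<^bsub>A\<^esub>) \<odot>\<^bsub>M\<^esub> x)\<rparr>"

lemma left_module_scal:
  assumes "left_module A M"
  shows "left_module K (scal M)"
proof -
  interpret M: left_module A M by fact
  have "abelian_group (scal M)"
  proof (rule abelian_groupI)
    fix x assume "x \<in> carrier (scal M)"
    then show "\<exists>y\<in>carrier (scal M). y \<oplus>\<^bsub>scal M\<^esub> x = \<zero>\<^bsub>scal M\<^esub>"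
      by (intro bexI[of _ "\<ominus>\<^bsub>M\<^esub> x"]) (auto simp: scal_def M.M.l_neg)
  qed (auto simp: scal_def M.M.a_ac)
  moreover have "left_module_axioms K (scal M)"
  proof
    fix a b x assume ab: "a \<in> carrier K" "b \<in> carrier K" and x: "x \<in> carrier (scal M)"
    \<comment> \<open>Compatibility of scalars with the product of \<open>A\<close> makes the map
      from \<open>K\<close> to \<open>A\<close> multiplicative.\<close>
    have "(a \<otimes>\<^bsub>K\<^esub> b) \<odot>\<^bsub>A\<^esub> \<one>\<^bsub>A\<^esub> = (a \<odot>\<^bsub>A\<^esub> \<one>\<^bsub>A\<^esub>) \<otimes>\<^bsub>A\<^esub> (b \<odot>\<^bsub>A\<^esub> \<one>\<^bsub>A\<^esub>)"
      using ab by (simp add: smult_mult_left smult_assoc1)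
    then show "(a \<otimes>\<^bsub>K\<^esub> b) \<odot>\<^bsub>scal M\<^esub> x = a \<odot>\<^bsub>scal M\<^esub> (b \<odot>\<^bsub>scal M\<^esub> x)"
      using ab x by (simp add: scal_def M.smult_assoc1)
  qed (auto simp: scal_def smult_l_distr M.smult_l_distr M.smult_r_distr)
  ultimately show ?thesis by (intro left_module.intro K.ring_axioms)
qed

lemma submodule_scal:
  assumes "left_module A M" "submodule U A M"
  shows "submodule U K (scal M)"
proof -
  interpret M: left_module A M by fact
  interpret S: left_module K "scal M" by (rule left_module_scal) fact
  show ?thesis using M.submoduleD[OF assms(2)] by (auto simp: S.submodule_iff) (auto simp: scal_def)
qed

text \<open>A substitute for the dimension over \<open>K\<close>. Products of generators of
  \<open>A\<close> over \<open>K\<close> with generators of \<open>M\<close> over \<open>A\<close>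
  are put into \<open>U\<close>; then \<open>U\<close> is all of \<open>M\<close>, and intersecting
  with it loses nothing.\<close>

lemma ex_submodule_size:
  assumes "M \<in> mod_cat A"
  obtains \<mu> :: "'a list set \<Rightarrow> nat" where
    "\<And>U W. \<lbrakk>submodule U A M; submodule W A M; U \<subset> W\<rbrakk> \<Longrightarrow> \<mu> U < \<mu> W"
proof -
  interpret M: left_module A M using assms by (rule mod_catD)
  interpret S: left_module K "scal M" by (rule left_module_scal) (rule M.left_module_axioms)
  interpret L: left_module K A by (rule left_module_K_A)
  obtain G where G: "finite G" "G \<subseteq> carrier M"
    "\<And>U. submodule U A M \<Longrightarrow> G \<subseteq> U \<Longrightarrow> U = carrier M"
    using assms M.finitely_generated_iff by (auto simp: mod_cat_def)
  obtain B where B: "finite B" "B \<subseteq> carrier A"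
    "\<And>U. submodule U K A \<Longrightarrow> B \<subseteq> U \<Longrightarrow> U = carrier A"
    using finite_dimensional L.finitely_generated_iff by auto
  have sc [simp]: "carrier (scal M) = carrier M" "zero (scal M) = zero M" "add (scal M) = add M"
    "smult (scal M) = (\<lambda>c x. (c \<odot>\<^bsub>A\<^esub> \<one>\<^bsub>A\<^esub>) \<odot>\<^bsub>M\<^esub> x)"
    by (simp_all add: scal_def)
  define F where "F = (\<lambda>(b, g). b \<odot>\<^bsub>M\<^esub> g) ` (B \<times> G)"
  have "finite F" "F \<subseteq> carrier (scal M)" using B G by (auto simp: F_def)
  from ex_submodule_size_on[OF K.field_axioms left_module_scal[OF M.left_module_axioms] this]
  obtain U \<mu> where U: "submodule U K (scal M)" "F \<subseteq> U"
    and size: "\<forall>W W'. submodule W K (scal M) \<and> submodule W' K (scal M) \<and> W \<subseteq> W' \<longrightarrow>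
      \<mu> W \<le> (\<mu> W' :: nat) \<and> (W \<inter> U \<noteq> W' \<inter> U \<longrightarrow> \<mu> W < \<mu> W')"
    by (elim exE conjE) simp
  have \<mu>: "\<mu> W < \<mu> W'" if "submodule W K (scal M)" "submodule W' K (scal M)" "W \<subseteq> W'"
    "W \<inter> U \<noteq> W' \<inter> U" for W W'
    using size that by simp
  note u = S.submoduleD[OF U(1), simplified]
  have AG: "a \<odot>\<^bsub>M\<^esub> g \<in> U" if "a \<in> carrier A" "g \<in> G" for a g
  proof -
    have g: "g \<in> carrier M" using that G by blast
    \<comment> \<open>For fixed \<open>g\<close> these scalars form a subspace of \<open>A\<close>
      that contains the generators \<open>B\<close>, hence all of \<open>A\<close>.\<close>
    have "submodule {a \<in> carrier A. a \<odot>\<^bsub>M\<^esub> g \<in> U} K A"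
      unfolding L.submodule_iff
    proof (intro conjI ballI)
      fix c a assume c: "c \<in> carrier K" and "a \<in> {a \<in> carrier A. a \<odot>\<^bsub>M\<^esub> g \<in> U}"
      then have a: "a \<in> carrier A" "a \<odot>\<^bsub>M\<^esub> g \<in> U" by auto
      have "c \<odot>\<^bsub>A\<^esub> a = (c \<odot>\<^bsub>A\<^esub> \<one>\<^bsub>A\<^esub>) \<otimes>\<^bsub>A\<^esub> a" using a c by (simp add: smult_mult_left)
      then have "(c \<odot>\<^bsub>A\<^esub> a) \<odot>\<^bsub>M\<^esub> g = (c \<odot>\<^bsub>A\<^esub> \<one>\<^bsub>A\<^esub>) \<odot>\<^bsub>M\<^esub> (a \<odot>\<^bsub>M\<^esub> g)"
        using a c g by (simp add: M.smult_assoc1)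
      then show "c \<odot>\<^bsub>A\<^esub> a \<in> {a \<in> carrier A. a \<odot>\<^bsub>M\<^esub> g \<in> U}" using a c u(5) by simp
    qed (use u(3,4) g in \<open>auto simp: M.smult_l_distr\<close>)
    moreover have "B \<subseteq> {a \<in> carrier A. a \<odot>\<^bsub>M\<^esub> g \<in> U}"
      using B(2) U(2) that(2) by (auto simp: F_def)
    ultimately have "{a \<in> carrier A. a \<odot>\<^bsub>M\<^esub> g \<in> U} = carrier A" by (rule B(3))
    then show ?thesis using that(1) by blast
  qed
  \<comment> \<open>This is the largest \<open>A\<close>-submodule inside \<open>U\<close>; it
    contains \<open>G\<close>, hence is \<open>M\<close>.\<close>
  have "submodule {x \<in> carrier M. \<forall>a\<in>carrier A. a \<odot>\<^bsub>M\<^esub> x \<in> U} A M"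
    using u(3,4) by (auto simp: M.submodule_iff M.smult_r_distr simp flip: M.smult_assoc1)
  then have "{x \<in> carrier M. \<forall>a\<in>carrier A. a \<odot>\<^bsub>M\<^esub> x \<in> U} = carrier M"
    by (rule G(3)) (use AG G(2) in auto)
  then have "\<one>\<^bsub>A\<^esub> \<odot>\<^bsub>M\<^esub> x \<in> U" if "x \<in> carrier M" for x
    using that A.one_closed by blast
  then have cU: "carrier M \<subseteq> U" by (auto simp: subset_iff)
  show ?thesis
  proof (rule that[of \<mu>])
    fix X Y assume XY: "submodule X A M" "submodule Y A M" "X \<subset> Y"
    then have "X \<inter> U = X" "Y \<inter> U = Y" using M.submoduleD(1) cU by blast+
    then show "\<mu> X < \<mu> Y"
      using XY by (intro \<mu> submodule_scal M.left_module_axioms) auto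
  qed
qed

text \<open>An injective map preserves strict inclusions, so a proper image would yield a strictly
  descending sequence of iterated images, on which the natural number \<open>\<mu>\<close> drops
  forever.\<close>

lemma inj_endo_surj:
  assumes M: "M \<in> mod_cat A" and f: "f \<in> mod_hom A M M" and inj: "inj_on f (carrier M)"
  shows "f ` carrier M = carrier M"
proof (rule ccontr)
  assume ne: "f ` carrier M \<noteq> carrier M"
  interpret M: left_module A M using M by (rule mod_catD)
  obtain \<mu> :: "'a list set \<Rightarrow> nat" where
    \<mu>: "\<And>U W. \<lbrakk>submodule U A M; submodule W A M; U \<subset> W\<rbrakk> \<Longrightarrow> \<mu> U < \<mu> W"
    using ex_submodule_size[OF M] by blast
  have "False" if "submodule U A M" "f ` U \<subset> U" for U
    using that
  proof (induction "\<mu> U" arbitrary: U rule: less_induct)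
    case less
    have sub: "submodule (f ` U) A M"
      by (rule submodule_image[OF M.left_module_axioms M.left_module_axioms f less.prems(1)])
    have "f ` f ` U \<noteq> f ` U"
      using inj_on_image_eq_iff[OF inj] less.prems M.submoduleD(1) sub by (metis psubsetE)
    then have "f ` f ` U \<subset> f ` U" using less.prems(2) by blast
    then show False using less sub \<mu> by blast
  qed
  moreover have "f ` carrier M \<subset> carrier M" using ne mod_homD(1)[OF f] by blast
  ultimately show False using M.submodule_carrier by blast
qed

end

subsection \<open>Isomorphism classes\<close>

lemma mod_iso_nonzero:
  assumes "left_module R M" "left_module R N" "f \<in> mod_iso R M N" "carrier M \<noteq> {\<zero>\<^bsub>M\<^esub>}"
  shows "f \<noteq> zero_hom M N"
proof
  interpret M: left_module R M by fact
  assume f: "f = zero_hom M N"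
  obtain x where x: "x \<in> carrier M" "x \<noteq> \<zero>\<^bsub>M\<^esub>" using assms(4) M.M.zero_closed by blast
  have "inj_on f (carrier M)" using assms(3) by (simp add: mod_iso_def bij_betw_def)
  moreover have "f x = f \<zero>\<^bsub>M\<^esub>" using x(1) by (simp add: f)
  ultimately show False using x by (auto dest: inj_onD)
qed

text \<open>Conjugation by the given isomorphisms preserves being non-zero and being non-invertible.
  This moves the morphisms of a cycle to chosen representatives.\<close>

lemma nonzero_noniso_transfer:
  assumes lm: "left_module R X" "left_module R Y" "left_module R M" "left_module R N"
    and iso: "\<phi> \<in> mod_iso R X M" "\<psi> \<in> mod_iso R Y N"
    and f: "f \<in> mod_hom R X Y" "f \<noteq> zero_hom X Y" "f \<notin> mod_iso R X Y"
  obtains h where "h \<in> mod_hom R M N" "h \<noteq> zero_hom M N" "h \<notin> mod_iso R M N"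
proof -
  have hom: "\<phi> \<in> mod_hom R X M" "\<psi> \<in> mod_hom R Y N"
    and bij: "bij_betw \<phi> (carrier X) (carrier M)" "bij_betw \<psi> (carrier Y) (carrier N)"
    using iso by (auto simp: mod_iso_def)
  note phi = mod_homD[OF hom(1)] and psi = mod_homD[OF hom(2)] and ff = mod_homD[OF f(1)]
  define \<phi>' where "\<phi>' = restrict (inv_into (carrier X) \<phi>) (carrier M)"
  define \<psi>' where "\<psi>' = restrict (inv_into (carrier Y) \<psi>) (carrier N)"
  note i1 = mod_iso_inverse[OF lm(1,3) iso(1), folded \<phi>'_def]
    and i2 = mod_iso_inverse[OF lm(2,4) iso(2), folded \<psi>'_def]
  have h1: "\<phi>' \<in> mod_hom R M X" using i1(1) by (simp add: mod_iso_def)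
  define h where "h = compose (carrier M) (compose (carrier X) \<psi> f) \<phi>'"
  have h: "h \<in> mod_hom R M N"
    unfolding h_def by (intro mod_hom_compose[OF lm(3) h1] mod_hom_compose[OF lm(1) f(1) hom(2)])
  have hphi: "h (\<phi> x) = \<psi> (f x)" if "x \<in> carrier X" for x
    using that phi(1) by (simp add: h_def compose_def i1(2))
  obtain x where x: "x \<in> carrier X" "f x \<noteq> \<zero>\<^bsub>Y\<^esub>"
    using f(2) mod_hom_eq_zero_iff[OF f(1)] by blast
  interpret Y: left_module R Y by fact
  have "\<psi> (f x) \<noteq> \<zero>\<^bsub>N\<^esub>"
    using x ff(1) i2(2)[of "f x"] i2(2)[of "\<zero>\<^bsub>Y\<^esub>"] mod_hom_zero[OF lm(2,4) hom(2)] by auto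
  then have "h \<noteq> zero_hom M N"
    using hphi[OF x(1)] phi(1)[OF x(1)] by (metis restrict_apply')
  moreover have "h \<notin> mod_iso R M N"
  proof
    assume "h \<in> mod_iso R M N"
    from mod_iso_compose[OF lm(1) mod_iso_compose[OF lm(1) iso(1) this] i2(1)]
    have k: "compose (carrier X) \<psi>' (compose (carrier X) h \<phi>) \<in> mod_iso R X Y" .
    \<comment> \<open>Undoing the conjugation recovers \<open>f\<close>, which would then be an
      isomorphism.\<close>
    have "compose (carrier X) \<psi>' (compose (carrier X) h \<phi>) = f"
      by (rule extensionalityI[OF compose_extensional ff(4)])
        (simp add: compose_def hphi i2(2) ff(1))
    then show False using k f(3) by simp
  qed
  ultimately show ?thesis using h by (rule that[rotated])
qed

lemma mod_isomorphic_sym: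
  assumes "left_module R M" "left_module R N" "mod_isomorphic R M N"
  shows "mod_isomorphic R N M"
  using assms mod_iso_inverse(1)[OF assms(1,2)] by (auto simp: mod_isomorphic_def)

lemma mod_isomorphic_trans:
  assumes "left_module R L" "mod_isomorphic R L M" "mod_isomorphic R M N"
  shows "mod_isomorphic R L N"
  using assms(2,3) mod_iso_compose[OF assms(1)] unfolding mod_isomorphic_def by blast

lemma equiv_iso_rel: "equiv (mod_cat A) (iso_rel A)"
proof (rule equivI)
  show "iso_rel A \<subseteq> mod_cat A \<times> mod_cat A" by (auto simp: iso_rel_def)
  have "mod_isomorphic A M M" if "M \<in> mod_cat A" for M
    using mod_iso_id[OF mod_catD[OF that]] by (auto simp: mod_isomorphic_def)
  then show "refl_on (mod_cat A) (iso_rel A)" by (auto simp: refl_on_def iso_rel_def)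
  show "sym (iso_rel A)"
    by (auto simp: sym_def iso_rel_def intro: mod_isomorphic_sym mod_catD)
  show "trans (iso_rel A)"
    by (rule transI) (auto simp: iso_rel_def intro: mod_isomorphic_trans mod_catD)
qed

lemma iso_class_eq_iff:
  assumes "M \<in> mod_cat A" "N \<in> mod_cat A"
  shows "iso_rel A `` {M} = iso_rel A `` {N} \<longleftrightarrow> mod_isomorphic A M N"
  using eq_equiv_class_iff[OF equiv_iso_rel assms] assms by (simp add: iso_rel_def)

subsection \<open>Chains of torsion classes\<close>

text \<open>The left Hom-orthogonal of \<open>S\<close>. A morphism out of a factor module vanishes
  if its composite with the epimorphism does; on an extension, a morphism that vanishes on the
  submodule factors through the quotient.\<close>

lemma torsion_class_left_perp:
  assumes "ring A" "S \<subseteq> mod_cat A"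
  shows "torsion_class A {X \<in> mod_cat A. \<forall>Y\<in>S. \<forall>f\<in>mod_hom A X Y. f = zero_hom X Y}"
    (is "torsion_class A ?T")
  unfolding torsion_class_def
proof (intro conjI ballI impI)
  show "?T \<subseteq> mod_cat A" by blast
  obtain Z where Z: "Z \<in> mod_cat A" "carrier Z = {\<zero>\<^bsub>Z\<^esub>}"
    using zero_module_in_mod_cat[OF assms(1)] by blast
  have "f = zero_hom Z Y" if "Y \<in> S" "f \<in> mod_hom A Z Y" for Y f
  proof -
    have "left_module A Y" using that(1) assms(2) mod_catD by blast
    then show ?thesis
      using mod_hom_zero[OF mod_catD[OF Z(1)] _ that(2)] Z(2) mod_hom_eq_zero_iff[OF that(2)] by simp
  qed
  then have "Z \<in> ?T" using Z(1) by blast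
  then show "?T \<noteq> {}" by blast
next
  fix M N assume M: "M \<in> ?T" and N: "N \<in> mod_cat A" and "\<exists>g\<in>mod_hom A M N. g ` carrier M = carrier N"
  then obtain g where g: "g \<in> mod_hom A M N" "g ` carrier M = carrier N" by blast
  have "f = zero_hom N Y" if Y: "Y \<in> S" and f: "f \<in> mod_hom A N Y" for Y f
  proof -
    have "compose (carrier M) f g \<in> mod_hom A M Y"
      using M by (intro mod_hom_compose[OF _ g(1) f] mod_catD) blast
    then have "compose (carrier M) f g = zero_hom M Y" using M Y by blast
    then have "f (g x) = \<zero>\<^bsub>Y\<^esub>" if "x \<in> carrier M" for x
      using that by (metis compose_eq restrict_apply')
    then have "\<forall>y\<in>g ` carrier M. f y = \<zero>\<^bsub>Y\<^esub>" by blast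
    then show ?thesis unfolding g(2) mod_hom_eq_zero_iff[OF f] .
  qed
  then show "N \<in> ?T" using N by blast
next
  fix L N M assume L: "L \<in> ?T" and N: "N \<in> ?T" and M: "M \<in> mod_cat A" and "\<exists>f g. short_exact A L f M g N"
  then obtain f g where fg: "f \<in> mod_hom A L M" "g \<in> mod_hom A M N" "g ` carrier M = carrier N"
    "f ` carrier L = {x \<in> carrier M. g x = \<zero>\<^bsub>N\<^esub>}" by (auto simp: short_exact_def)
  have lm: "left_module A L" "left_module A M" "left_module A N"
    using L M N mod_catD by blast+
  have "h = zero_hom M Y" if Y: "Y \<in> S" and h: "h \<in> mod_hom A M Y" for Y h
  proof -
    have lmY: "left_module A Y" using Y assms(2) mod_catD by blast
    have "compose (carrier L) h f = zero_hom L Y"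
      using L Y mod_hom_compose[OF lm(1) fg(1) h] by blast
    then have hf: "h (f x) = \<zero>\<^bsub>Y\<^esub>" if "x \<in> carrier L" for x
      using that by (metis compose_eq restrict_apply')
    have "h x = \<zero>\<^bsub>Y\<^esub>" if x: "x \<in> carrier M" "g x = \<zero>\<^bsub>N\<^esub>" for x
    proof -
      have "x \<in> f ` carrier L" using fg(4) x by simp
      then show ?thesis using hf by blast
    qed
    then obtain k where k: "k \<in> mod_hom A N Y" "\<And>x. x \<in> carrier M \<Longrightarrow> k (g x) = h x"
      using mod_hom_factor[OF lm(2,3) lmY fg(2,3) h] by blast
    have "k = zero_hom N Y" using N Y k(1) by blast
    then have "h x = \<zero>\<^bsub>Y\<^esub>" if "x \<in> carrier M" for x
      using that k(2)[OF that] mod_homD(1)[OF fg(2) that] by simp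
    then show ?thesis unfolding mod_hom_eq_zero_iff[OF h] by blast
  qed
  then show "M \<in> ?T" using M by blast
qed

section \<open>Bricks in the gaps between torsion classes\<close>

context fin_dim_algebra
begin

text \<open>
  Take a quotient of some module in \<open>T' - T\<close> that is minimal among the quotients outside \<open>T\<close>.
  The image of a non-zero morphism from \<open>T\<close>, the image of a non-injective endomorphism, or a
  decomposition would exhibit it as a member of \<open>T\<close>.
\<close>

lemma ex_brick_between:
  assumes T: "torsion_class A T" and T': "torsion_class A T'" and less: "T \<subset> T'"
  obtains M where "M \<in> T'" "M \<in> mod_cat A" "indecomposable A M"
    "\<And>L f. \<lbrakk>L \<in> T; f \<in> mod_hom A L M\<rbrakk> \<Longrightarrow> f = zero_hom L M"
    "\<And>f. \<lbrakk>f \<in> mod_hom A M M; f \<noteq> zero_hom M M\<rbrakk> \<Longrightarrow> f \<in> mod_iso A M M"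
proof -
  obtain M0 where M0: "M0 \<in> T'" "M0 \<notin> T" using less by blast
  then have M0c: "M0 \<in> mod_cat A" using torsion_classD(1)[OF T'] by blast
  then interpret M0: left_module A M0 by (rule mod_catD)
  obtain \<mu> :: "'a list set \<Rightarrow> nat" where
    \<mu>: "\<And>U W. \<lbrakk>submodule U A M0; submodule W A M0; U \<subset> W\<rbrakk> \<Longrightarrow> \<mu> U < \<mu> W"
    using ex_submodule_size[OF M0c] by blast
  \<comment> \<open>A predicate on kernels rather than quotients, because \<open>\<mu>\<close>
    measures submodules of \<open>M0\<close>; a kernel of greatest size gives a quotient that is
    minimal outside \<open>T\<close>.\<close>
  define P where "P U \<longleftrightarrow> submodule U A M0 \<and> (\<exists>Q p. Q \<in> T' \<and> Q \<notin> T \<and> p \<in> mod_hom A M0 Q \<and>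
    p ` carrier M0 = carrier Q \<and> {x \<in> carrier M0. p x = \<zero>\<^bsub>Q\<^esub>} = U)" for U
  have "P {\<zero>\<^bsub>M0\<^esub>}"
    unfolding P_def using M0 mod_iso_id[OF M0.left_module_axioms]
    by (intro conjI exI[of _ M0] exI[of _ "\<lambda>x\<in>carrier M0. x"] M0.submodule_zero)
      (auto simp: mod_iso_def)
  \<comment> \<open>The value of \<open>\<mu>\<close> at the whole of \<open>M0\<close> bounds all
    others; the successor makes the bound strict.\<close>
  moreover have "\<forall>U. P U \<longrightarrow> \<mu> U < Suc (\<mu> (carrier M0))"
    using \<mu>[OF _ M0.submodule_carrier] M0.submoduleD(1) by (metis P_def less_Suc_eq psubsetI)
  ultimately obtain U where U: "P U" "\<And>V. P V \<Longrightarrow> \<mu> V \<le> \<mu> U"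
    using ex_has_greatest_nat[of P _ \<mu>] by blast
  then obtain M p where M: "M \<in> T'" "M \<notin> T" and p: "p \<in> mod_hom A M0 M"
    "p ` carrier M0 = carrier M" "{x \<in> carrier M0. p x = \<zero>\<^bsub>M\<^esub>} = U" and sU: "submodule U A M0"
    unfolding P_def by blast
  have Mc: "M \<in> mod_cat A" using M torsion_classD(1)[OF T'] by blast
  then interpret M: left_module A M by (rule mod_catD)
  \<comment> \<open>A non-zero element killed by \<open>g\<close> makes the kernel of the composite
    from \<open>M0\<close> strictly larger than \<open>U\<close>; for \<open>N\<close> outside
    \<open>T\<close> this contradicts the choice of \<open>U\<close>.\<close>
  have quot: "N \<in> T" if N: "N \<in> mod_cat A" and g: "g \<in> mod_hom A M N" "g ` carrier M = carrier N"
    and x: "x \<in> carrier M" "x \<noteq> \<zero>\<^bsub>M\<^esub>" "g x = \<zero>\<^bsub>N\<^esub>" for N g x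
  proof (rule ccontr)
    assume "N \<notin> T"
    note lmN = mod_catD[OF N]
    define q where "q = compose (carrier M0) g p"
    define V where "V = {y \<in> carrier M0. q y = \<zero>\<^bsub>N\<^esub>}"
    have q: "q \<in> mod_hom A M0 N" "q ` carrier M0 = carrier N"
      using mod_hom_compose[OF M0.left_module_axioms p(1) g(1)] surj_compose[OF p(2) g(2)]
      by (simp_all add: q_def)
    have sV: "submodule V A M0"
      unfolding V_def by (rule submodule_kernel[OF M0.left_module_axioms lmN q(1)])
    have "N \<in> T'" by (rule torsion_classD(3)[OF T' M(1) N g])
    then have "P V" unfolding P_def using sV q \<open>N \<notin> T\<close> V_def by blast
    have "U \<subseteq> V"
      using p(3) mod_hom_zero[OF M.left_module_axioms lmN g(1)]
      by (auto simp: V_def q_def compose_def)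
    moreover obtain y where "y \<in> carrier M0" "x = p y" using p(2) x(1) by blast
    then have "y \<in> V" "y \<notin> U" using x p(3) by (auto simp: V_def q_def compose_def)
    ultimately have "\<mu> U < \<mu> V" using \<mu>[OF sU sV] by blast
    then show False using U(2)[OF \<open>P V\<close>] by simp
  qed
  \<comment> \<open>The image of \<open>f\<close> is in \<open>T\<close> as a factor of
    \<open>L\<close>, and the quotient by it is in \<open>T\<close> by \<open>quot\<close>; closure
    under extensions would put \<open>M\<close> in \<open>T\<close>.\<close>
  have perp: "f = zero_hom L M" if L: "L \<in> T" and f: "f \<in> mod_hom A L M" for L f
  proof (rule ccontr)
    assume "f \<noteq> zero_hom L M"
    then obtain x where x: "x \<in> carrier L" "f x \<noteq> \<zero>\<^bsub>M\<^esub>" using mod_hom_eq_zero_iff[OF f] by blast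
    have Lc: "L \<in> mod_cat A" using L torsion_classD(1)[OF T] by blast
    define I where "I = M\<lparr>carrier := f ` carrier L\<rparr>"
    note im = mod_hom_onto_image[OF Lc Mc f, folded I_def]
    have "I \<in> T" by (rule torsion_classD(3)[OF T L im(1,2)]) (simp add: I_def)
    obtain Q r where Q: "Q \<in> mod_cat A" "r \<in> mod_hom A M Q" "r ` carrier M = carrier Q"
      "{x \<in> carrier M. r x = \<zero>\<^bsub>Q\<^esub>} = f ` carrier L"
      by (rule quotient_in_mod_cat[OF Mc im(3)])
    have "f x \<in> {x \<in> carrier M. r x = \<zero>\<^bsub>Q\<^esub>}" using Q(4) x(1) by simp
    then have "Q \<in> T" using quot[OF Q(1-3), of "f x"] x(2) by simp
    have "short_exact A I (\<lambda>x\<in>f ` carrier L. x) M r Q"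
      unfolding short_exact_def
      using mod_hom_inclusion[OF M.left_module_axioms im(3)] Q by (simp add: I_def inj_on_def)
    then have "M \<in> T" by (rule torsion_classD(4)[OF T \<open>I \<in> T\<close> \<open>Q \<in> T\<close> Mc])
    then show False using M by simp
  qed
  \<comment> \<open>A non-injective endomorphism has its image in \<open>T\<close> by
    \<open>quot\<close>, and the inclusion of that image vanishes by \<open>perp\<close>. An
    injective one is onto by \<open>inj_endo_surj\<close>.\<close>
  have endo: "f \<in> mod_iso A M M" if f: "f \<in> mod_hom A M M" "f \<noteq> zero_hom M M" for f
  proof -
    have "x = \<zero>\<^bsub>M\<^esub>" if x: "x \<in> carrier M" "f x = \<zero>\<^bsub>M\<^esub>" for x
    proof (rule ccontr)
      assume "x \<noteq> \<zero>\<^bsub>M\<^esub>"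
      define I where "I = M\<lparr>carrier := f ` carrier M\<rparr>"
      note im = mod_hom_onto_image[OF Mc Mc f(1), folded I_def]
      have I: "carrier I = f ` carrier M" "zero I = zero M" by (simp_all add: I_def)
      have "I \<in> T" by (rule quot[OF im(1,2) _ x(1) \<open>x \<noteq> \<zero>\<^bsub>M\<^esub>\<close>]) (simp_all add: I x)
      moreover have "(\<lambda>x\<in>carrier I. x) \<in> mod_hom A I M"
        using mod_hom_inclusion[OF M.left_module_axioms im(3)] by (simp add: I_def)
      ultimately have "(\<lambda>x\<in>carrier I. x) = zero_hom I M" by (rule perp)
      then have "f y = \<zero>\<^bsub>M\<^esub>" if "y \<in> carrier M" for y
        using that by (metis I(1) imageI restrict_apply')
      then show False using f mod_hom_eq_zero_iff[OF f(1)] by blast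
    qed
    then have inj: "inj_on f (carrier M)"
      by (rule inj_on_mod_homI[OF M.left_module_axioms M.left_module_axioms f(1)])
    then show ?thesis using inj_endo_surj[OF Mc f(1) inj] f(1) by (simp add: mod_iso_def bij_betw_def)
  qed
  have "indecomposable A M"
    unfolding indecomposable_def
  proof (intro conjI allI impI)
    show "carrier M \<noteq> {\<zero>\<^bsub>M\<^esub>}" using torsion_class_zero[OF T Mc] M(2) by blast
  next
    \<comment> \<open>From here \<open>U\<close> and \<open>V\<close> are the two summands;
      \<open>U\<close> hides the kernel chosen earlier.\<close>
    fix U V assume "submodule U A M \<and> submodule V A M \<and> U \<inter> V = {\<zero>\<^bsub>M\<^esub>} \<and> U <+>\<^bsub>M\<^esub> V = carrier M"
    then have sub: "submodule U A M" "submodule V A M" and UV: "U \<inter> V = {\<zero>\<^bsub>M\<^esub>}"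
      "U <+>\<^bsub>M\<^esub> V = carrier M" by auto
    note u = M.submoduleD[OF sub(1)] and v = M.submoduleD[OF sub(2)]
    show "U = {\<zero>\<^bsub>M\<^esub>} \<or> V = {\<zero>\<^bsub>M\<^esub>}"
    proof (rule ccontr)
      assume "\<not> (U = {\<zero>\<^bsub>M\<^esub>} \<or> V = {\<zero>\<^bsub>M\<^esub>})"
      then obtain x y where xy: "x \<in> U" "x \<noteq> \<zero>\<^bsub>M\<^esub>" "y \<in> V" "y \<noteq> \<zero>\<^bsub>M\<^esub>"
        using u(3) v(3) by blast
      obtain Q r where Q: "Q \<in> mod_cat A" "r \<in> mod_hom A M Q" "r ` carrier M = carrier Q"
        "{x \<in> carrier M. r x = \<zero>\<^bsub>Q\<^esub>} = V"
        by (rule quotient_in_mod_cat[OF Mc sub(2)])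
      have rV: "r z = \<zero>\<^bsub>Q\<^esub> \<longleftrightarrow> z \<in> V" if "z \<in> carrier M" for z using Q(4) that by blast
      note lmQ = mod_catD[OF Q(1)] and r = mod_homD[OF Q(2)]
      interpret Q: left_module A Q by (rule lmQ)
      \<comment> \<open>As \<open>V\<close> is not zero, \<open>quot\<close> applies to the quotient
        by \<open>V\<close>. That quotient is isomorphic to \<open>U\<close>, so it would map
        non-trivially into \<open>M\<close>, against \<open>perp\<close>.\<close>
      have "Q \<in> T" using quot[OF Q(1-3), of y] xy v(2) rV by blast
      define N where "N = M\<lparr>carrier := U\<rparr>"
      have N: "carrier N = U" "zero N = zero M" "add N = add M" "smult N = smult M"
        by (simp_all add: N_def)
      have lmN: "left_module A N" unfolding N_def by (rule M.left_module_submodule[OF sub(1)])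
      define s where "s = (\<lambda>x\<in>U. r x)"
      have s: "s \<in> mod_hom A N Q"
        by (rule mod_homI) (use r u in \<open>auto simp: N s_def\<close>)
      have "inj_on s (carrier N)"
      proof (rule inj_on_mod_homI[OF lmN lmQ s])
        fix z assume "z \<in> carrier N" "s z = \<zero>\<^bsub>Q\<^esub>"
        then have "z \<in> U" "z \<in> V" using rV u(2) by (simp_all add: N s_def)
        then show "z = \<zero>\<^bsub>N\<^esub>" using UV(1) N by auto
      qed
      moreover have "s ` carrier N = carrier Q"
      proof
        show "s ` carrier N \<subseteq> carrier Q" using mod_homD(1)[OF s] by blast
        show "carrier Q \<subseteq> s ` carrier N"
        proof
          fix z assume "z \<in> carrier Q"
          then obtain w where w: "w \<in> carrier M" "z = r w" using Q(3) by blast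
          then have "w \<in> U <+>\<^bsub>M\<^esub> V" using UV(2) by simp
          then obtain a b where ab: "a \<in> U" "b \<in> V" "w = a \<oplus>\<^bsub>M\<^esub> b"
            by (auto simp: set_add_def')
          then have "z = r a" using w rV[of b] u(2) v(2) r by simp
          then show "z \<in> s ` carrier N" using ab by (auto simp: s_def N)
        qed
      qed
      ultimately have "s \<in> mod_iso A N Q" using s by (simp add: mod_iso_def bij_betw_def)
      note inv = mod_iso_inverse[OF lmN lmQ this]
      define t where "t = restrict (inv_into (carrier N) s) (carrier Q)"
      have t: "t \<in> mod_hom A Q N" "t (s x) = x"
        using inv(1) inv(2)[of x] xy(1) by (simp_all add: t_def mod_iso_def N)
      have "t \<in> mod_hom A Q M"
        by (rule mod_homI) (use mod_homD[OF t(1)] u N in auto)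
      then have "t = zero_hom Q M" using \<open>Q \<in> T\<close> by (rule perp[rotated])
      then have "t (s x) = \<zero>\<^bsub>M\<^esub>" using mod_homD(1)[OF s, of x] xy(1) by (simp add: N)
      then show False using t(2) xy(2) by simp
    qed
  qed
  then show ?thesis using that[OF M(1) Mc] perp endo by blast
qed

text \<open>The module \<open>M i\<close> is taken from the gap between \<open>x i\<close> and
  \<open>x (Suc i)\<close>. For \<open>j < i\<close> the module \<open>M j\<close> already lies in
  \<open>x i\<close>, from which no non-zero morphism reaches \<open>M i\<close>.\<close>

lemma tors_chain_bricks:
  assumes carr: "\<forall>i\<le>r. x i \<in> carrier (tors A)" and less: "\<forall>i<r. x i \<sqsubset>\<^bsub>tors A\<^esub> x (Suc i)"
  obtains M :: "nat \<Rightarrow> ('a, 'a list) module" where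
    "\<And>i. i < r \<Longrightarrow> M i \<in> mod_cat A \<and> indecomposable A (M i)"
    "\<And>i f. \<lbrakk>i < r; f \<in> mod_hom A (M i) (M i); f \<noteq> zero_hom (M i) (M i)\<rbrakk> \<Longrightarrow> f \<in> mod_iso A (M i) (M i)"
    "\<And>i j f. \<lbrakk>j < i; i < r; f \<in> mod_hom A (M j) (M i)\<rbrakk> \<Longrightarrow> f = zero_hom (M j) (M i)"
proof -
  have tc: "torsion_class A (x i)" if "i \<le> r" for i using carr that by (simp add: tors_def)
  have sub: "x i \<subset> x (Suc i)" if "i < r" for i
    using less that by (auto simp: tors_def lless_def)
  have "\<exists>M. M \<in> x (Suc i) \<and> M \<in> mod_cat A \<and> indecomposable A M \<and>
      (\<forall>L\<in>x i. \<forall>f\<in>mod_hom A L M. f = zero_hom L M) \<and>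
      (\<forall>f\<in>mod_hom A M M. f \<noteq> zero_hom M M \<longrightarrow> f \<in> mod_iso A M M)" if i: "i < r" for i
  proof -
    obtain M where "M \<in> x (Suc i)" "M \<in> mod_cat A" "indecomposable A M"
      "\<And>L f. \<lbrakk>L \<in> x i; f \<in> mod_hom A L M\<rbrakk> \<Longrightarrow> f = zero_hom L M"
      "\<And>f. \<lbrakk>f \<in> mod_hom A M M; f \<noteq> zero_hom M M\<rbrakk> \<Longrightarrow> f \<in> mod_iso A M M"
      using ex_brick_between[OF tc tc sub[OF i]] i by auto
    then show ?thesis by (intro exI[of _ M]) simp
  qed
  \<comment> \<open>The guard moves under the existential so that choice gives a function on all
    indices.\<close>
  then have "\<forall>i. \<exists>M. i < r \<longrightarrow> M \<in> x (Suc i) \<and> M \<in> mod_cat A \<and> indecomposable A M \<and>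
      (\<forall>L\<in>x i. \<forall>f\<in>mod_hom A L M. f = zero_hom L M) \<and>
      (\<forall>f\<in>mod_hom A M M. f \<noteq> zero_hom M M \<longrightarrow> f \<in> mod_iso A M M)" by blast
  from choice[OF this] obtain M where M: "\<forall>i<r. M i \<in> x (Suc i) \<and> M i \<in> mod_cat A \<and>
      indecomposable A (M i) \<and> (\<forall>L\<in>x i. \<forall>f\<in>mod_hom A L (M i). f = zero_hom L (M i)) \<and>
      (\<forall>f\<in>mod_hom A (M i) (M i). f \<noteq> zero_hom (M i) (M i) \<longrightarrow> f \<in> mod_iso A (M i) (M i))"
    by (rule exE)
  have mono: "x j \<subseteq> x i" if "j \<le> i" "i \<le> r" for i j
    using that
  proof (induction i rule: dec_induct)
    case (step n)
    then show ?case using sub[of n] by auto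
  qed simp
  have "M j \<in> x i" if "j < i" "i < r" for i j
    using M mono[of "Suc j" i] that by auto
  then show ?thesis using M by (intro that[of M]) blast+
qed

end

subsection \<open>Representation-directed algebras\<close>

text \<open>Topological sorting. Well-foundedness of the converse gives an element of
  \<open>S\<close> without successors in \<open>S\<close>; it becomes the head, so arrows of
  \<open>r\<close> inside \<open>S\<close> lead from later to earlier entries.\<close>

lemma finite_acyclic_sorted_list:
  assumes "finite S" "finite r" "acyclic r"
  shows "\<exists>xs. set xs = S \<and> distinct xs \<and> sorted_wrt (\<lambda>x y. (x, y) \<notin> r) xs"
  using assms(1)
proof (induction S rule: finite_psubset_induct)
  case (psubset S)
  show ?case
  proof (cases "S = {}")
    case False
    have "wf (r\<inverse>)" using assms(2,3) by (rule finite_acyclic_wf_converse)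
    then obtain m where m: "m \<in> S" "\<And>y. (y, m) \<in> r\<inverse> \<Longrightarrow> y \<notin> S"
      using False by (metis wfE_min all_not_in_conv)
    then obtain xs where "set xs = S - {m}" "distinct xs" "sorted_wrt (\<lambda>x y. (x, y) \<notin> r) xs"
      using psubset.IH[of "S - {m}"] by blast
    then show ?thesis using m by (intro exI[of _ "m # xs"]) auto
  qed simp
qed

text \<open>Turns the morphisms of cycles into steps of a relation, so that directedness becomes
  acyclicity and can feed the topological sorting.\<close>

definition noniso_rel :: "('a, 'r) ring_scheme \<Rightarrow> ('a, 'a list) module rel" where
  "noniso_rel A = {(X, Y). X \<in> mod_cat A \<and> indecomposable A X \<and> Y \<in> mod_cat A \<and> indecomposable A Y \<and>
    (\<exists>f\<in>mod_hom A X Y. f \<noteq> zero_hom X Y \<and> f \<notin> mod_iso A X Y)}"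

text \<open>A closed walk unfolds into a cycle whose ends are equal, hence isomorphic through the
  identity.\<close>

lemma acyclic_noniso_rel:
  assumes "rep_directed A"
  shows "acyclic (noniso_rel A)"
  unfolding acyclic_def
proof (intro allI notI)
  fix X assume "(X, X) \<in> (noniso_rel A)\<^sup>+"
  then obtain n where "n > 0" "(X, X) \<in> noniso_rel A ^^ n" using trancl_power by blast
  then obtain Y where Y: "Y 0 = X" "Y n = X" "\<And>i. i < n \<Longrightarrow> (Y i, Y (Suc i)) \<in> noniso_rel A"
    using relpow_fun_conv[of X X n "noniso_rel A"] by blast
  then have "\<forall>i<n. \<exists>f. f \<in> mod_hom A (Y i) (Y (Suc i)) \<and> f \<noteq> zero_hom (Y i) (Y (Suc i)) \<and>
      f \<notin> mod_iso A (Y i) (Y (Suc i))"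
    unfolding noniso_rel_def by blast
  then obtain f where f: "\<And>i. i < n \<Longrightarrow> f i \<in> mod_hom A (Y i) (Y (Suc i)) \<and>
      f i \<noteq> zero_hom (Y i) (Y (Suc i)) \<and> f i \<notin> mod_iso A (Y i) (Y (Suc i))"
    by metis
  have X: "X \<in> mod_cat A" "indecomposable A X"
    using Y(1) Y(3)[of 0] \<open>n > 0\<close> by (auto simp: noniso_rel_def)
  have Yi: "Y i \<in> mod_cat A \<and> indecomposable A (Y i)" if "i \<le> n" for i
    using Y(2,3) X that by (cases "i = n") (auto simp: noniso_rel_def)
  \<comment> \<open>The chosen \<open>f i\<close> starts at \<open>Y i\<close>, whereas
    \<open>mod_cycle\<close> gives index \<open>i\<close> to the morphism ending at
    \<open>Y i\<close>; hence the shift.\<close>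
  have "mod_cycle A n Y (\<lambda>i. f (i - 1))"
    unfolding mod_cycle_def
  proof (intro conjI allI ballI impI)
    show "n \<ge> 1" using \<open>n > 0\<close> by simp
    show "mod_isomorphic A (Y 0) (Y n)"
      using Y(1,2) mod_iso_id[OF mod_catD[OF X(1)]] by (auto simp: mod_isomorphic_def)
  next
    fix i assume "i \<in> {1..n}"
    then have i: "i - 1 < n" "Suc (i - 1) = i" by auto
    note fi = f[OF i(1), unfolded i(2)]
    show "f (i - 1) \<in> mod_hom A (Y (i - 1)) (Y i)" "f (i - 1) \<noteq> zero_hom (Y (i - 1)) (Y i)"
      "f (i - 1) \<notin> mod_iso A (Y (i - 1)) (Y i)" using fi by blast+
  qed (use Yi in auto)
  then show False using assms X Y(1) unfolding rep_directed_def by blast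
qed

text \<open>A non-zero non-invertible endomorphism is by itself a cycle of length one.\<close>

lemma rep_directed_endo_iso:
  assumes "rep_directed A" "X \<in> mod_cat A" "indecomposable A X"
    and "f \<in> mod_hom A X X" "f \<noteq> zero_hom X X"
  shows "f \<in> mod_iso A X X"
proof (rule ccontr)
  assume "f \<notin> mod_iso A X X"
  then have "(X, X) \<in> noniso_rel A" using assms by (auto simp: noniso_rel_def)
  then show False using acyclic_noniso_rel[OF assms(1)] by (auto simp: acyclic_def)
qed

text \<open>The inverse map of a bijective endomorphism is again a homomorphism, hence an inverse in
  the endomorphism ring.\<close>

lemma bricksI:
  assumes M: "M \<in> mod_cat A" "carrier M \<noteq> {\<zero>\<^bsub>M\<^esub>}"
    and endo: "\<And>f. \<lbrakk>f \<in> mod_hom A M M; f \<noteq> zero_hom M M\<rbrakk> \<Longrightarrow> f \<in> mod_iso A M M"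
  shows "M \<in> bricks A"
proof -
  note lm = mod_catD[OF M(1)]
  interpret M: left_module A M by (rule lm)
  interpret E: ring "end_ring A M" using lm by (rule ring_end_ring)
  have m: "carrier (end_ring A M) = mod_hom A M M"
    "mult (end_ring A M) = compose (carrier M)" "one (end_ring A M) = (\<lambda>x\<in>carrier M. x)"
    "zero (end_ring A M) = zero_hom M M"
    by (simp_all add: end_ring_def)
  have ne: "(\<lambda>x\<in>carrier M. x) \<noteq> zero_hom M M"
    using mod_iso_nonzero[OF lm lm mod_iso_id[OF lm] M(2)] .
  have "Units (end_ring A M) = carrier (end_ring A M) - {\<zero>\<^bsub>end_ring A M\<^esub>}"
  proof
    \<comment> \<open>If zero were a unit, the identity would be the zero map, impossible on a
      non-zero module.\<close>
    have "\<zero>\<^bsub>end_ring A M\<^esub> \<notin> Units (end_ring A M)"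
    proof
      assume "\<zero>\<^bsub>end_ring A M\<^esub> \<in> Units (end_ring A M)"
      then have "\<one>\<^bsub>end_ring A M\<^esub> = \<zero>\<^bsub>end_ring A M\<^esub>"
        using E.Units_l_inv E.Units_inv_closed E.r_null by metis
      then show False using ne by (simp add: m)
    qed
    then show "Units (end_ring A M) \<subseteq> carrier (end_ring A M) - {\<zero>\<^bsub>end_ring A M\<^esub>}"
      using E.Units_closed by blast
    show "carrier (end_ring A M) - {\<zero>\<^bsub>end_ring A M\<^esub>} \<subseteq> Units (end_ring A M)"
    proof
      fix f assume "f \<in> carrier (end_ring A M) - {\<zero>\<^bsub>end_ring A M\<^esub>}"
      then have f: "f \<in> mod_hom A M M" "f \<in> mod_iso A M M" using endo by (auto simp: m)
      define g where "g = restrict (inv_into (carrier M) f) (carrier M)"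
      note inv = mod_iso_inverse[OF lm lm f(2), folded g_def]
      have "g \<in> mod_hom A M M" using inv(1) by (simp add: mod_iso_def)
      moreover have "compose (carrier M) g f = (\<lambda>x\<in>carrier M. x)"
        "compose (carrier M) f g = (\<lambda>x\<in>carrier M. x)"
        using inv(2,3) by (auto simp: compose_def fun_eq_iff)
      ultimately show "f \<in> Units (end_ring A M)" using f(1) by (auto simp: Units_def m)
    qed
  qed
  then have "div_ring (end_ring A M)"
    by (intro div_ring.intro E.ring_axioms div_ring_axioms.intro)
  then show ?thesis using M(1) by (simp add: bricks_def)
qed

text \<open>Indecomposables are bricks here because their non-zero endomorphisms are invertible, so
  their classes are among the finitely many brick classes.\<close>

lemma rep_directed_imp_rep_finite:
  assumes "rep_directed A" "brick_finite A"
  shows "rep_finite A"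
proof -
  have "{M \<in> mod_cat A. indecomposable A M} \<subseteq> bricks A"
  proof
    fix M assume "M \<in> {M \<in> mod_cat A. indecomposable A M}"
    then have M: "M \<in> mod_cat A" "indecomposable A M" by simp_all
    show "M \<in> bricks A"
      by (rule bricksI[OF M(1) _ rep_directed_endo_iso[OF assms(1) M]])
        (use M(2) in \<open>simp_all add: indecomposable_def\<close>)
  qed
  then have "ind A \<subseteq> bricks A // iso_rel A" unfolding ind_def quotient_def by blast
  then show ?thesis
    using assms(2) finite_subset unfolding rep_finite_def brick_finite_def by blast
qed

section \<open>Lengths of chains compared with the number of indecomposables\<close>

context fin_dim_algebra
begin

text \<open>For \<open>j < i\<close> an isomorphism from \<open>M j\<close> to \<open>M i\<close>
  would be a non-zero morphism, as indecomposables are non-zero. So the modules of the chain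
  represent \<open>r\<close> different classes.\<close>

lemma tors_chain_classes:
  assumes carr: "\<forall>i\<le>r. x i \<in> carrier (tors A)" and less: "\<forall>i<r. x i \<sqsubset>\<^bsub>tors A\<^esub> x (Suc i)"
  obtains M :: "nat \<Rightarrow> ('a, 'a list) module" where
    "\<And>i. i < r \<Longrightarrow> M i \<in> mod_cat A \<and> indecomposable A (M i)"
    "\<And>i f. \<lbrakk>i < r; f \<in> mod_hom A (M i) (M i); f \<noteq> zero_hom (M i) (M i)\<rbrakk> \<Longrightarrow> f \<in> mod_iso A (M i) (M i)"
    "\<And>i j f. \<lbrakk>j < i; i < r; f \<in> mod_hom A (M j) (M i)\<rbrakk> \<Longrightarrow> f = zero_hom (M j) (M i)"
    "\<And>i j. \<lbrakk>j < i; i < r\<rbrakk> \<Longrightarrow> \<not> mod_isomorphic A (M j) (M i)"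
    "inj_on (\<lambda>i. iso_rel A `` {M i}) {..<r}" "(\<lambda>i. iso_rel A `` {M i}) ` {..<r} \<subseteq> ind A"
proof -
  obtain M where M: "\<And>i. i < r \<Longrightarrow> M i \<in> mod_cat A \<and> indecomposable A (M i)"
    "\<And>i f. \<lbrakk>i < r; f \<in> mod_hom A (M i) (M i); f \<noteq> zero_hom (M i) (M i)\<rbrakk> \<Longrightarrow> f \<in> mod_iso A (M i) (M i)"
    "\<And>i j f. \<lbrakk>j < i; i < r; f \<in> mod_hom A (M j) (M i)\<rbrakk> \<Longrightarrow> f = zero_hom (M j) (M i)"
  proof (rule tors_chain_bricks[OF carr less], goal_cases)
    case (1 M)
    show ?case by (rule that[of M]) (fact 1)+
  qed
  have noniso: "\<not> mod_isomorphic A (M j) (M i)" if ji: "j < i" "i < r" for i j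
  proof
    assume "mod_isomorphic A (M j) (M i)"
    then obtain f where f: "f \<in> mod_iso A (M j) (M i)" by (auto simp: mod_isomorphic_def)
    have "f \<noteq> zero_hom (M j) (M i)"
      using M(1)[of i] M(1)[of j] ji
      by (intro mod_iso_nonzero[OF _ _ f] mod_catD) (auto simp: indecomposable_def)
    then show False using M(3)[OF ji] f by (simp add: mod_iso_def)
  qed
  have inj: "inj_on (\<lambda>i. iso_rel A `` {M i}) {..<r}"
  proof (rule linorder_inj_onI)
    fix j i assume "j < i" "i \<in> {..<r}"
    then show "iso_rel A `` {M j} \<noteq> iso_rel A `` {M i}"
      using noniso[of j i] M(1)[of i] M(1)[of j] by (simp add: iso_class_eq_iff)
  qed auto
  have "(\<lambda>i. iso_rel A `` {M i}) ` {..<r} \<subseteq> ind A"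
    using M(1) by (auto simp: ind_def intro!: quotientI)
  from that[OF M noniso inj this] show ?thesis .
qed

lemma tors_chain_length_le:
  assumes "rep_finite A" "\<forall>i\<le>r. x i \<in> carrier (tors A)" "\<forall>i<r. x i \<sqsubset>\<^bsub>tors A\<^esub> x (Suc i)"
  shows "r \<le> card (ind A)"
proof -
  have "finite (ind A)" using assms(1) by (simp add: rep_finite_def)
  show ?thesis
  proof (rule tors_chain_classes[OF assms(2,3)], goal_cases)
    case (1 M)
    from card_inj_on_le[OF 1(5,6) \<open>finite (ind A)\<close>] show ?case by simp
  qed
qed

text \<open>Along a cycle the index of the representative strictly decreases, yet the isomorphic
  ends force it to return.\<close>

lemma long_tors_chain_imp_rep_directed:
  assumes fin: "rep_finite A"
    and chain: "\<forall>i\<le>card (ind A). x i \<in> carrier (tors A)"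
      "\<forall>i<card (ind A). x i \<sqsubset>\<^bsub>tors A\<^esub> x (Suc i)"
  shows "rep_directed A"
proof -
  define n where "n = card (ind A)"
  obtain M where M: "\<And>i. i < n \<Longrightarrow> M i \<in> mod_cat A \<and> indecomposable A (M i)"
    and endo: "\<And>i f. \<lbrakk>i < n; f \<in> mod_hom A (M i) (M i); f \<noteq> zero_hom (M i) (M i)\<rbrakk> \<Longrightarrow> f \<in> mod_iso A (M i) (M i)"
    and zero: "\<And>i j f. \<lbrakk>j < i; i < n; f \<in> mod_hom A (M j) (M i)\<rbrakk> \<Longrightarrow> f = zero_hom (M j) (M i)"
    and noniso: "\<And>i j. \<lbrakk>j < i; i < n\<rbrakk> \<Longrightarrow> \<not> mod_isomorphic A (M j) (M i)"
    and inj: "inj_on (\<lambda>i. iso_rel A `` {M i}) {..<n}" and sub: "(\<lambda>i. iso_rel A `` {M i}) ` {..<n} \<subseteq> ind A"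
  proof (rule tors_chain_classes[OF chain[folded n_def]], goal_cases)
    case (1 M)
    show ?case by (rule that[of M]) (fact 1)+
  qed
  \<comment> \<open>There are as many modules in the chain as classes, so the injection is onto and
    every indecomposable is isomorphic to some \<open>M i\<close>.\<close>
  have ind_eq: "(\<lambda>i. iso_rel A `` {M i}) ` {..<n} = ind A"
    using fin sub inj by (intro card_subset_eq) (simp_all add: rep_finite_def card_image n_def)
  have ind_class: "\<exists>i<n. mod_isomorphic A X (M i)" if "X \<in> mod_cat A" "indecomposable A X" for X
  proof -
    have "iso_rel A `` {X} \<in> ind A" using that by (auto simp: ind_def intro: quotientI)
    then have "iso_rel A `` {X} \<in> (\<lambda>i. iso_rel A `` {M i}) ` {..<n}" by (simp only: ind_eq)
    then obtain i where i: "i < n" "iso_rel A `` {X} = iso_rel A `` {M i}" by (elim imageE) simp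
    have "mod_isomorphic A X (M i)"
      using i(2) iso_class_eq_iff[OF that(1) conjunct1[OF M[OF i(1)]]] by (rule iffD1[rotated])
    then show ?thesis using i(1) by blast
  qed
  have "False" if cyc: "mod_cycle A t X f" for t X f
  proof -
    have X: "X i \<in> mod_cat A" "indecomposable A (X i)" if "i \<le> t" for i
      using cyc that by (auto simp: mod_cycle_def)
    have "\<forall>i\<le>t. \<exists>j<n. mod_isomorphic A (X i) (M j)" using ind_class X by blast
    then obtain \<sigma> where \<sigma>: "\<And>i. i \<le> t \<Longrightarrow> \<sigma> i < n \<and> mod_isomorphic A (X i) (M (\<sigma> i))" by metis
    \<comment> \<open>After transfer to representatives, \<open>zero\<close> forbids a non-zero
      morphism from a smaller to a larger index, and for equal indices \<open>endo\<close> would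
      make it an isomorphism.\<close>
    have step: "\<sigma> (Suc i) < \<sigma> i" if i: "Suc i \<le> t" for i
    proof -
      have lt: "\<sigma> i < n" "\<sigma> (Suc i) < n" using \<sigma> i by simp_all
      have lm: "left_module A (X i)" "left_module A (X (Suc i))"
        "left_module A (M (\<sigma> i))" "left_module A (M (\<sigma> (Suc i)))"
        using X(1) M lt i by (auto intro!: mod_catD)
      obtain \<phi> \<psi> where "\<phi> \<in> mod_iso A (X i) (M (\<sigma> i))" "\<psi> \<in> mod_iso A (X (Suc i)) (M (\<sigma> (Suc i)))"
        using \<sigma>[of i] \<sigma>[of "Suc i"] i by (auto simp: mod_isomorphic_def)
      moreover have "f (Suc i) \<in> mod_hom A (X i) (X (Suc i))"
        "f (Suc i) \<noteq> zero_hom (X i) (X (Suc i))" "f (Suc i) \<notin> mod_iso A (X i) (X (Suc i))"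
      proof -
        have "\<forall>i\<in>{1..t}. f i \<in> mod_hom A (X (i - 1)) (X i) \<and> f i \<noteq> zero_hom (X (i - 1)) (X i) \<and>
            f i \<notin> mod_iso A (X (i - 1)) (X i)"
          using cyc by (simp add: mod_cycle_def)
        from bspec[OF this, of "Suc i"] show
          "f (Suc i) \<in> mod_hom A (X i) (X (Suc i))" "f (Suc i) \<noteq> zero_hom (X i) (X (Suc i))"
          "f (Suc i) \<notin> mod_iso A (X i) (X (Suc i))"
          using i by simp_all
      qed
      ultimately obtain h where h: "h \<in> mod_hom A (M (\<sigma> i)) (M (\<sigma> (Suc i)))"
        "h \<noteq> zero_hom (M (\<sigma> i)) (M (\<sigma> (Suc i)))" "h \<notin> mod_iso A (M (\<sigma> i)) (M (\<sigma> (Suc i)))"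
        by (rule nonzero_noniso_transfer[OF lm])
      have "\<sigma> i \<noteq> \<sigma> (Suc i)"
      proof
        assume eq: "\<sigma> i = \<sigma> (Suc i)"
        show False using endo[OF lt(1)] h unfolding eq by blast
      qed
      moreover have "\<not> \<sigma> i < \<sigma> (Suc i)" using zero[OF _ lt(2) h(1)] h(2) by blast
      ultimately show ?thesis by simp
    qed
    \<comment> \<open>Each step lowers the index by at least one, and \<open>t \<ge> 1\<close> makes
      the total drop positive.\<close>
    have "\<sigma> i + i \<le> \<sigma> 0" if "i \<le> t" for i
      using that
    proof (induction i)
      case (Suc i)
      then show ?case using step[of i] by simp
    qed simp
    moreover have "t \<ge> 1" using cyc by (simp add: mod_cycle_def)
    ultimately have lt: "\<sigma> t < \<sigma> 0" using add_leD1 by fastforce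
    have "mod_isomorphic A (X 0) (X t)" using cyc by (simp add: mod_cycle_def)
    then have "iso_rel A `` {X 0} = iso_rel A `` {X t}" using X(1) by (simp add: iso_class_eq_iff)
    moreover have "iso_rel A `` {X i} = iso_rel A `` {M (\<sigma> i)}" if "i \<le> t" for i
      using \<sigma>[OF that] X(1)[OF that] M by (simp add: iso_class_eq_iff)
    ultimately have "iso_rel A `` {M (\<sigma> t)} = iso_rel A `` {M (\<sigma> 0)}" by simp
    then show False using noniso[OF lt] \<sigma>[of 0] \<sigma>[of t] M by (simp add: iso_class_eq_iff)
  qed
  then show ?thesis unfolding rep_directed_def by blast
qed

text \<open>Representatives are sorted so that no non-zero morphism goes from an earlier to a later
  one. The chain consists of left orthogonals of final segments of the list; each step drops one
  test module.\<close>

lemma rep_directed_long_tors_chain: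
  assumes dir: "rep_directed A" and fin: "rep_finite A"
  shows "\<exists>x. (\<forall>i\<le>card (ind A). x i \<in> carrier (tors A)) \<and>
    (\<forall>i<card (ind A). x i \<sqsubset>\<^bsub>tors A\<^esub> x (Suc i))"
proof -
  have "\<forall>C\<in>ind A. \<exists>M. M \<in> mod_cat A \<and> indecomposable A M \<and> C = iso_rel A `` {M}"
    by (auto simp: ind_def elim!: quotientE)
  then obtain rep where rep: "\<And>C. C \<in> ind A \<Longrightarrow> rep C \<in> mod_cat A \<and> indecomposable A (rep C) \<and> C = iso_rel A `` {rep C}"
    by metis
  define S where "S = rep ` ind A"
  have "inj_on rep (ind A)" using rep by (metis inj_onI)
  then have card: "card S = card (ind A)" by (simp add: S_def card_image)
  have S: "M \<in> mod_cat A" "indecomposable A M" if "M \<in> S" for M using that rep by (auto simp: S_def)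
  have noniso: "\<not> mod_isomorphic A M N" if MN: "M \<in> S" "N \<in> S" "M \<noteq> N" for M N
  proof
    assume "mod_isomorphic A M N"
    then have "iso_rel A `` {M} = iso_rel A `` {N}" using S MN by (simp add: iso_class_eq_iff)
    then show False using MN rep by (auto simp: S_def)
  qed
  have "finite S" using fin by (simp add: S_def rep_finite_def)
  \<comment> \<open>Restricting to \<open>S\<close> makes the relation finite, as the sorting
    requires.\<close>
  define r where "r = noniso_rel A \<inter> S \<times> S"
  have "finite r" "acyclic r"
    using \<open>finite S\<close> acyclic_subset[OF acyclic_noniso_rel[OF dir]] by (auto simp: r_def)
  then obtain xs where xs: "set xs = S" "distinct xs" "sorted_wrt (\<lambda>x y. (x, y) \<notin> r) xs"
    using finite_acyclic_sorted_list[OF \<open>finite S\<close>] by blast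
  define n where "n = card (ind A)"
  have len: "length xs = n" using xs(1,2) card distinct_card n_def by metis
  have xsS: "xs ! i \<in> S" if "i < n" for i using that xs(1) len by auto
  have zero: "f = zero_hom (xs ! i) (xs ! j)"
    if ij: "i < j" "j < n" and f: "f \<in> mod_hom A (xs ! i) (xs ! j)" for i j f
  proof (rule ccontr)
    assume "f \<noteq> zero_hom (xs ! i) (xs ! j)"
    \<comment> \<open>Different representatives are non-isomorphic, so a non-zero morphism between
      them is an arrow of \<open>r\<close>.\<close>
    moreover have "xs ! i \<noteq> xs ! j" using ij xs(2) len by (simp add: nth_eq_iff_index_eq)
    then have "f \<notin> mod_iso A (xs ! i) (xs ! j)"
      using noniso[of "xs ! i" "xs ! j"] xsS ij by (auto simp: mod_isomorphic_def)
    ultimately have "(xs ! i, xs ! j) \<in> r"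
      using f xsS S ij by (auto simp: r_def noniso_rel_def)
    then show False using sorted_wrt_nth_less[OF xs(3)] ij len by blast
  qed
  \<comment> \<open>Indices start at zero: \<open>x n\<close> tests against nothing and equals
    \<open>mod_cat A\<close>, and the chain has exactly \<open>n\<close> steps.\<close>
  define x where "x i = {X \<in> mod_cat A. \<forall>Y\<in>{xs ! j | j. i \<le> j \<and> j < n}.
    \<forall>f\<in>mod_hom A X Y. f = zero_hom X Y}" for i
  have "torsion_class A (x i)" for i
    unfolding x_def using xsS S(1) by (intro torsion_class_left_perp A.ring_axioms) auto
  then have "x i \<in> carrier (tors A)" for i by (simp add: tors_def)
  moreover have "x i \<sqsubset>\<^bsub>tors A\<^esub> x (Suc i)" if i: "i < n" for i
  proof -
    let ?M = "xs ! i"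
    have M: "?M \<in> mod_cat A" "carrier ?M \<noteq> {\<zero>\<^bsub>?M\<^esub>}" using S xsS i by (auto simp: indecomposable_def)
    note lm = mod_catD[OF M(1)]
    have id: "(\<lambda>y\<in>carrier ?M. y) \<in> mod_iso A ?M ?M" by (rule mod_iso_id[OF lm])
    then have "(\<lambda>y\<in>carrier ?M. y) \<in> mod_hom A ?M ?M" by (simp add: mod_iso_def)
    \<comment> \<open>The identity is a non-zero morphism to a module against which
      \<open>x i\<close> tests.\<close>
    then have "?M \<notin> x i" using mod_iso_nonzero[OF lm lm id M(2)] i unfolding x_def by blast
    moreover have "?M \<in> x (Suc i)" using zero M(1) by (auto simp: x_def)
    moreover have "x i \<subseteq> x (Suc i)" unfolding x_def using Suc_leD by blast
    ultimately have "x i \<subset> x (Suc i)" by blast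
    then show ?thesis by (auto simp: lless_def tors_def)
  qed
  ultimately show ?thesis unfolding n_def by blast
qed

end

theorem corollary1p9:
  fixes K :: "('k, 'r) ring_scheme" and A :: "('k, 'a, 's) module_scheme"
  assumes "fin_dim_algebra K A" and "brick_finite A"
  shows "rep_directed A \<longleftrightarrow>
    rep_finite A \<and> lattice_length (tors A) = card (ind A)"
proof -
  interpret fin_dim_algebra K A by fact
  \<comment> \<open>The predicate under \<open>GREATEST\<close> in
    \<open>lattice_length\<close>.\<close>
  let ?P = "\<lambda>r. \<exists>x. (\<forall>i\<le>r. x i \<in> carrier (tors A)) \<and> (\<forall>i<r. x i \<sqsubset>\<^bsub>tors A\<^esub> x (Suc i))"
  show ?thesis
  proof
    assume dir: "rep_directed A"
    have fin: "rep_finite A" by (rule rep_directed_imp_rep_finite[OF dir assms(2)])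
    have "lattice_length (tors A) = card (ind A)"
      unfolding lattice_length_def
    proof (rule Greatest_equality)
      show "?P (card (ind A))" by (rule rep_directed_long_tors_chain[OF dir fin])
    next
      fix r assume "?P r"
      then show "r \<le> card (ind A)" using tors_chain_length_le[OF fin] by blast
    qed
    then show "rep_finite A \<and> lattice_length (tors A) = card (ind A)" using fin by blast
  next
    assume R: "rep_finite A \<and> lattice_length (tors A) = card (ind A)"
    \<comment> \<open>A single torsion class is a chain of length zero. Together with the bound on
      all chains this ensures that \<open>GREATEST\<close> is attained, so a chain of length
      \<open>card (ind A)\<close> really exists.\<close>
    have "torsion_class A (mod_cat A)"
      using torsion_class_left_perp[OF A.ring_axioms, of "{}"] by simp
    then have "?P 0" by (auto simp: tors_def)
    moreover have "r \<le> card (ind A)" if "?P r" for r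
      using that tors_chain_length_le R by blast
    ultimately have "?P (lattice_length (tors A))"
      unfolding lattice_length_def by (rule GreatestI_nat)
    then show "rep_directed A" using R long_tors_chain_imp_rep_directed by auto
  qed
qed

end
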